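(* Let $\Gamma$ be a subgroup of $\mathrm{PC}^{\bowtie}(\mathbf{S})$. Suppose that \begin{enumerate} \item $\Gamma$ includes a subgroup $\Lambda$ of rotations that has $\mathbf{Q}$-rank $\ge 2$, or is infinitely generated and of $\mathbf{Q}$-rank $1$; \item $\Gamma$ includes, for some proper nonzero interval of $\mathbf{S}$, some dense subgroup of the corresponding group of partial rotations; \item $\Gamma$ contains a 132-flip or a triple flip. \end{enumerate} Then $\Gamma$ is not realizable.
   Context: Let $\mathbf{S}=\mathbf{R}/\mathbf{Z}$. Let $\widehat{\mathrm{PC}^{\bowtie}}(\mathbf{S})$ be the group of permutations of $\mathbf{S}$ that are continuous outside a finite subset, and $\mathrm{PC}^{\bowtie}(\mathbf{S})$ its quotient by the normal subgroup of finitely supported permutations, with quotient homomorphism $\pi$. A subgroup $\Gamma\subset\mathrm{PC}^{\bowtie}(\mathbf{S})$ is realizable if there is a subgroup $\tilde\Gamma$ of $\widehat{\mathrm{PC}^{\bowtie}}(\mathbf{S})$ such that $\pi$ restricts to a bijection $\tilde\Gamma\to\Gamma$. The $\mathbf{Q}$-rank of an abelian group $A$ is $\dim_{\mathbf{Q}}(A\otimes_{\mathbf{Z}}\mathbf{Q})$. Rotations are the maps $r_t:x\mapsto x+t$, $t\in\mathbf{R}/\mathbf{Z}$. For an interval $I$ of $\mathbf{S}$ of length $\ell\in\,]0,1[$, the corresponding group of partial rotations is the group (isomorphic to $\mathbf{R}/\ell\mathbf{Z}$) of elements acting as the identity outside $I$ and as rotations of the circle of length $\ell$ obtained from $\bar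 I$ by identifying its endpoints; density refers to $\mathbf{R}/\ell\mathbf{Z}$. The image of an interval under an element of $\mathrm{PC}^{\bowtie}(\mathbf{S})$ is understood modulo finite subsets. An element $f\in\mathrm{PC}^{\bowtie}(\mathbf{S})$ is a 132-flip if $f^2=\mathrm{id}$ and there are three consecutive intervals $I_1,I_2,I_3$ of nonzero length, partitioning $\mathbf{S}$ up to finite sets, such that $f$ has no singularity (point at which every representative is discontinuous) in the interior of any $I_j$, $f(I_1)=I_1$, $f(I_2)=I_3$, $f(I_3)=I_2$, and $f$ is orientation-reversing on $I_1$ and orientation-preserving on $I_2$ and $I_3$. It is a triple flip if $f^2=\mathrm{id}$ and there are three consecutive intervals $I_1,I_2,I_3$ of nonzero length partitioning $\mathbf{S}$ up to finite sets such that, for each $j$, $f$ preserves $I_j$ up to finite sets and is orientation-reversing on it (continuous in its interior). *)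

theory Defs
  imports
    "HOL-Analysis.Elementary_Topology"
    "HOL-Library.Extended_Nat"
    "HOL-Library.Real_Mod"
    "HOL-Algebra.Free_Abelian_Groups"
    "Jordan_Normal_Form.VS_Connect"
begin

section \<open>The circle\<close>

quotient_type circle = real / "\<lambda>x y :: real. x - y \<in> \<int>"
  morphisms rep_circle to_circle
proof (rule equivpI)
  show "reflp (\<lambda>x y :: real. x - y \<in> \<int>)"
    by (simp add: reflp_def)
  show "symp (\<lambda>x y :: real. x - y \<in> \<int>)"
    by (metis (no_types, lifting) Ints_minus minus_diff_eq sympI)
  show "transp (\<lambda>x y :: real. x - y \<in> \<int>)"
    by (metis (no_types, lifting) Ints_add diff_add_cancel add_diff_eq transpI)
qed

instantiation circle :: ab_group_add
begin

lift_definition zero_circle :: circle is "0 :: real" .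

lift_definition plus_circle :: "circle \<Rightarrow> circle \<Rightarrow> circle" is "(+)"
  by (metis (no_types, lifting) Ints_add add_diff_add)

lift_definition uminus_circle :: "circle \<Rightarrow> circle" is uminus
  by (metis (no_types, lifting) Ints_minus minus_diff_minus)

lift_definition minus_circle :: "circle \<Rightarrow> circle \<Rightarrow> circle" is "(-)"
  by (metis (no_types, lifting) Ints_diff diff_diff_eq2 diff_diff_eq add.commute diff_add_eq)

instance
  by standard (transfer; simp)+

end

instantiation circle :: topological_space
begin

definition open_circle :: "circle set \<Rightarrow> bool" where
  "open_circle U \<longleftrightarrow> open (to_circle -` U)"

instance
proof
  show "open (UNIV :: circle set)"
    by (simp add: open_circle_def)
  show "open (S \<inter> T)" if "open S" "open T" for S T :: "circle set"
    using that by (simp add: open_circle_def open_Int)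
  show "open (\<Union>K)" if "\<forall>S\<in>K. open S" for K :: "circle set set"
    using that by (auto simp: open_circle_def vimage_Union)
qed

end

lemma to_circle_eq_iff: "to_circle x = to_circle y \<longleftrightarrow> x - y \<in> \<int>"
  by (rule circle.abs_eq_iff)

lemma open_to_circle_image:
  assumes "open A"
  shows "open (to_circle ` A)"
proof -
  have "to_circle -` to_circle ` A = (\<Union>n\<in>\<int>. (\<lambda>x. x + n) ` A)"
  proof (intro equalityI subsetI)
    fix x assume "x \<in> to_circle -` to_circle ` A"
    then obtain y where "y \<in> A" "x - y \<in> \<int>"
      by (auto simp: to_circle_eq_iff)
    moreover have "x = y + (x - y)"
      by simp
    ultimately show "x \<in> (\<Union>n\<in>\<int>. (\<lambda>x. x + n) ` A)"
      by blast
  next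
    fix x assume "x \<in> (\<Union>n\<in>\<int>. (\<lambda>x. x + n) ` A)"
    then obtain y n where "n \<in> \<int>" "y \<in> A" "x = y + n"
      by blast
    then have "to_circle x = to_circle y"
      by (simp add: to_circle_eq_iff)
    with \<open>y \<in> A\<close> show "x \<in> to_circle -` to_circle ` A"
      by simp
  qed
  moreover have "open ((\<lambda>x. x + n) ` A)" for n
  proof -
    have "(\<lambda>x. x + n) ` A = (\<lambda>x. x - n) -` A"
      by (force simp: image_iff)
    then show ?thesis
      using assms by (auto intro!: open_vimage continuous_intros)
  qed
  ultimately show ?thesis
    by (auto simp: open_circle_def)
qed

instance circle :: t2_space
proof
  fix x y :: circle
  assume "x \<noteq> y"
  obtain a b where a: "x = to_circle a" and b: "y = to_circle b"
    by (metis Quotient_circle Quotient_abs_rep)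
  define e where "e = min (frac (a - b)) (1 - frac (a - b)) / 2"
  have "a - b \<notin> \<int>"
    using \<open>x \<noteq> y\<close> by (simp add: a b to_circle_eq_iff)
  then have fr: "0 < frac (a - b)" "frac (a - b) < 1"
    by (simp_all add: frac_gt_0_iff frac_lt_1)
  then have "e > 0"
    by (simp add: e_def)
  have "to_circle ` {a - e<..<a + e} \<inter> to_circle ` {b - e<..<b + e} = {}"
  proof (rule ccontr)
    assume "\<not> ?thesis"
    then obtain s t where st: "\<bar>s - a\<bar> < e" "\<bar>t - b\<bar> < e" "s - t \<in> \<int>"
      by (force simp: to_circle_eq_iff abs_less_iff)
    obtain n where n: "s - t = of_int n"
      using st(3) by (elim Ints_cases)
    define m where "m = n - \<lfloor>a - b\<rfloor>"
    have "\<bar>frac (a - b) - of_int m\<bar> < 2 * e"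
      using st n unfolding m_def frac_def by (simp add: abs_less_iff)
    moreover have "m \<le> 0 \<or> m \<ge> 1"
      by linarith
    then have "real_of_int m \<le> 0 \<or> real_of_int m \<ge> 1"
      by auto
    ultimately show False
      using fr unfolding e_def by (auto simp: abs_less_iff)
  qed
  moreover have "x \<in> to_circle ` {a - e<..<a + e}" "y \<in> to_circle ` {b - e<..<b + e}"
    using \<open>e > 0\<close> by (auto simp: a b)
  ultimately show "\<exists>U V. open U \<and> open V \<and> x \<in> U \<and> y \<in> V \<and> U \<inter> V = {}"
    by (meson open_to_circle_image open_greaterThanLessThan)
qed


section \<open>Piecewise continuous permutations\<close>

definition PC_hat :: "(circle \<Rightarrow> circle) monoid" where
  "PC_hat = \<lparr>carrier = {g. bij g \<and> finite {x. \<not> isCont g x}}, monoid.mult = (\<circ>), one = id\<rparr>"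

definition fin_supp_perms :: "(circle \<Rightarrow> circle) set" where
  "fin_supp_perms = {g. bij g \<and> finite {x. g x \<noteq> x}}"

text \<open>An element of the quotient is the coset consisting of all its representatives.\<close>

definition PC :: "(circle \<Rightarrow> circle) set monoid" where
  "PC = PC_hat Mod fin_supp_perms"

definition proj_PC :: "(circle \<Rightarrow> circle) \<Rightarrow> (circle \<Rightarrow> circle) set" where
  "proj_PC g = fin_supp_perms #>\<^bsub>PC_hat\<^esub> g"

definition realizable :: "(circle \<Rightarrow> circle) set set \<Rightarrow> bool" where
  "realizable \<Gamma> \<longleftrightarrow> (\<exists>H. subgroup H PC_hat \<and> bij_betw proj_PC H \<Gamma>)"


section \<open>The rational rank of an abelian group\<close>

text \<open>
  For a multiplicatively written abelian group \<open>A\<close>, the tensor product of \<open>A\<close> with the rationals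
  over the integers is the free abelian group on pairs \<open>(a, q)\<close> modulo the bilinearity relations.
\<close>

definition tensor_rat_rels :: "('a, 'b) monoid_scheme \<Rightarrow> ('a \<times> rat \<Rightarrow>\<^sub>0 int) set" where
  "tensor_rat_rels A =
     {frag_of (a \<otimes>\<^bsub>A\<^esub> b, q) - frag_of (a, q) - frag_of (b, q) | a b q.
        a \<in> carrier A \<and> b \<in> carrier A} \<union>
     {frag_of (a, q + r) - frag_of (a, q) - frag_of (a, r) | a q r. a \<in> carrier A}"

definition tensor_rat_group :: "('a, 'b) monoid_scheme \<Rightarrow> ('a \<times> rat \<Rightarrow>\<^sub>0 int) set monoid" where
  "tensor_rat_group A =
     (let F = free_Abelian_group (carrier A \<times> UNIV)
      in F Mod generate F (tensor_rat_rels A))"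

text \<open>
  The scalar \<open>q\<close> acts by sending the class of \<open>(a, r)\<close> to the class of \<open>(a, q * r)\<close>. The image of
  a coset under \<open>frag_extend \<dots>\<close> need not be a full coset, hence the product with the relation
  subgroup \<open>\<one>\<close>. The ring multiplication and unit of the record are not part of the
  vector space structure.
\<close>

definition tensor_rat ::
    "('a, 'b) monoid_scheme \<Rightarrow> (rat, ('a \<times> rat \<Rightarrow>\<^sub>0 int) set) module" where
  "tensor_rat A =
     \<lparr>carrier = carrier (tensor_rat_group A),
      monoid.mult = undefined,
      one = undefined,
      zero = \<one>\<^bsub>tensor_rat_group A\<^esub>,
      add = monoid.mult (tensor_rat_group A),
      smult = (\<lambda>q X. \<one>\<^bsub>tensor_rat_group A\<^esub> <#>\<^bsub>free_Abelian_group (carrier A \<times> UNIV)\<^esub>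
                      frag_extend (\<lambda>(a, r). frag_of (a, q * r)) ` X)\<rparr>"

text \<open>\<open>vectorspace.dim\<close> is only meaningful in the finite-dimensional case.\<close>

definition Q_rank :: "('a, 'b) monoid_scheme \<Rightarrow> enat" where
  "Q_rank A =
     (if vectorspace.fin_dim class_ring (tensor_rat A)
      then enat (vectorspace.dim class_ring (tensor_rat A)) else \<infinity>)"

definition finitely_generated :: "('a, 'b) monoid_scheme \<Rightarrow> bool" where
  "finitely_generated G \<longleftrightarrow> (\<exists>X. finite X \<and> X \<subseteq> carrier G \<and> generate G X = carrier G)"


section \<open>Rotations and partial rotations\<close>

definition rotation :: "circle \<Rightarrow> circle \<Rightarrow> circle" where
  "rotation t x = x + t"

definition rotations :: "(circle \<Rightarrow> circle) set set" where
  "rotations = range (\<lambda>t. proj_PC (rotation t))"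

text \<open>The unique \<open>u \<in> [0,1)\<close> such that \<open>x\<close> is the class of \<open>a + u\<close>.\<close>

lift_definition circle_offset :: "real \<Rightarrow> circle \<Rightarrow> real" is "\<lambda>a x. frac (x - a)"
proof -
  fix a x y :: real
  assume "x - y \<in> \<int>"
  then obtain n where "x - y = of_int n"
    by (elim Ints_cases)
  then have "x - a = (y - a) + of_int n"
    by simp
  then show "frac (x - a) = frac (y - a)"
    by (simp only: frac_def floor_add_int of_int_add) simp
qed

text \<open>
  Rotation by \<open>s\<close> (a real number taken modulo \<open>l\<close>) of the interval of length \<open>l\<close> starting
  at \<open>a\<close>, with its endpoints identified.
\<close>

definition partial_rotation :: "real \<Rightarrow> real \<Rightarrow> real \<Rightarrow> circle \<Rightarrow> circle" where
  "partial_rotation a l s x =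
     (if circle_offset a x < l then to_circle (a + (circle_offset a x + s) rmod l) else x)"

definition partial_rotations :: "real \<Rightarrow> real \<Rightarrow> (circle \<Rightarrow> circle) set set" where
  "partial_rotations a l = range (\<lambda>s. proj_PC (partial_rotation a l s))"

text \<open>
  Density in the group of partial rotations, a copy of the reals modulo \<open>l\<close>: a set is
  dense in that quotient of the real line iff its preimage in the real line is dense.
\<close>

definition dense_in_partial_rotations ::
    "real \<Rightarrow> real \<Rightarrow> (circle \<Rightarrow> circle) set set \<Rightarrow> bool" where
  "dense_in_partial_rotations a l P \<longleftrightarrow>
     closure {s. proj_PC (partial_rotation a l s) \<in> P} = UNIV"


section \<open>Flips\<close>

text \<open>
  In the following \<open>f\<close> is an element of \<open>PC\<close>, and an open arc is given by the end points
  \<open>a < b \<le> a + 1\<close> of a lift to the real line. All conditions on a representative \<open>g\<close> of \<open>f\<close> ignore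
  finite sets, so they do not depend on the choice of \<open>g\<close>.
  Orientation on an arc without singularities is read off from a continuous real-valued lift \<open>h\<close>
  that describes \<open>f\<close> on the arc up to finitely many points.
\<close>

definition arc :: "real \<Rightarrow> real \<Rightarrow> circle set" where
  "arc a b = to_circle ` {a<..<b}"

definition singularity :: "(circle \<Rightarrow> circle) set \<Rightarrow> circle \<Rightarrow> bool" where
  "singularity f x \<longleftrightarrow> (\<forall>g\<in>f. \<not> isCont g x)"

definition image_eq_mod_finite ::
    "(circle \<Rightarrow> circle) set \<Rightarrow> circle set \<Rightarrow> circle set \<Rightarrow> bool" where
  "image_eq_mod_finite f I J \<longleftrightarrow> (\<forall>g\<in>f. finite (g ` I - J) \<and> finite (J - g ` I))"

definition lifts_on ::
    "(circle \<Rightarrow> circle) set \<Rightarrow> real \<Rightarrow> real \<Rightarrow> (real \<Rightarrow> real) \<Rightarrow> bool" where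
  "lifts_on f a b h \<longleftrightarrow>
     continuous_on {a<..<b} h \<and>
     (\<forall>g\<in>f. finite {t \<in> {a<..<b}. g (to_circle t) \<noteq> to_circle (h t)})"

definition orientation_preserving_on ::
    "(circle \<Rightarrow> circle) set \<Rightarrow> real \<Rightarrow> real \<Rightarrow> bool" where
  "orientation_preserving_on f a b \<longleftrightarrow> (\<exists>h. lifts_on f a b h \<and> strict_mono_on {a<..<b} h)"

definition orientation_reversing_on ::
    "(circle \<Rightarrow> circle) set \<Rightarrow> real \<Rightarrow> real \<Rightarrow> bool" where
  "orientation_reversing_on f a b \<longleftrightarrow> (\<exists>h. lifts_on f a b h \<and> strict_antimono_on {a<..<b} h)"

text \<open>
  The three consecutive intervals are the arcs \<open>(a, b)\<close>, \<open>(b, c)\<close> and \<open>(c, a + 1)\<close>.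
  The other cyclic orientation merely exchanges the second and third interval.
\<close>

definition flip_132 :: "(circle \<Rightarrow> circle) set \<Rightarrow> bool" where
  "flip_132 f \<longleftrightarrow>
     f \<otimes>\<^bsub>PC\<^esub> f = \<one>\<^bsub>PC\<^esub> \<and>
     (\<exists>a b c. a < b \<and> b < c \<and> c < a + 1 \<and>
        (\<forall>x \<in> arc a b \<union> arc b c \<union> arc c (a + 1). \<not> singularity f x) \<and>
        image_eq_mod_finite f (arc a b) (arc a b) \<and>
        image_eq_mod_finite f (arc b c) (arc c (a + 1)) \<and>
        image_eq_mod_finite f (arc c (a + 1)) (arc b c) \<and>
        orientation_reversing_on f a b \<and>
        orientation_preserving_on f b c \<and>
        orientation_preserving_on f c (a + 1))"

definition triple_flip :: "(circle \<Rightarrow> circle) set \<Rightarrow> bool" where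
  "triple_flip f \<longleftrightarrow>
     f \<otimes>\<^bsub>PC\<^esub> f = \<one>\<^bsub>PC\<^esub> \<and>
     (\<exists>a b c. a < b \<and> b < c \<and> c < a + 1 \<and>
        (\<forall>x \<in> arc a b \<union> arc b c \<union> arc c (a + 1). \<not> singularity f x) \<and>
        (\<forall>(u, v) \<in> {(a, b), (b, c), (c, a + 1)}.
           image_eq_mod_finite f (arc u v) (arc u v) \<and> orientation_reversing_on f u v))"

end

theory Submission
  imports
    Defs
    "HOL-Analysis.Kronecker_Approximation_Theorem"
    "HOL-Analysis.Further_Topology"
begin

text \<open>
  Suppose \<open>\<Gamma>\<close> lifts to a group \<open>H\<close> of permutations; two elements of \<open>H\<close> that agree outside a
  finite set are equal. The rank hypothesis provides an infinite cyclic subgroup of infinite index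
  in \<open>\<Lambda>\<close>, which forces the lift of \<open>\<Lambda>\<close> to be conjugate, by a finitely supported permutation, to
  the group of genuine rotations. Commutators of lifted partial rotations with small rotations
  then yield, for every point \<open>x\<close> and a dense set of \<open>s\<close>, an element of \<open>H\<close> that moves \<open>x\<close> to \<open>x + s\<close>
  and is supported (modulo finite sets) near \<open>x\<close>, \<open>x + s\<close> and \<open>x + s - l\<close>. As elements with disjoint
  supports modulo finite sets commute in \<open>H\<close>, these switches show first that an element of \<open>H\<close>
  which is trivial modulo finite sets on a large enough open set is trivial there, and then that an
  involution \<open>f\<close> in \<open>H\<close> maps every point \<open>x\<close> to one of the one-sided limits of \<open>f\<close> at \<open>x\<close>. For both
  kinds of flips this makes \<open>f\<close> a fixed point free involution of the three end points of the
  intervals.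
\<close>

section \<open>Permutations modulo finite sets\<close>

text \<open>A single irrational rotation \<open>r\<close> does not suffice for the straightening:
  the permutation that fixes one point \<open>x\<close>, sends the preimage of \<open>x\<close>
  under \<open>r\<close> to \<open>r x\<close> and agrees with \<open>r\<close> elsewhere generates
  a lift of the group generated by \<open>r\<close>, but its fixed point prevents any conjugacy to
  \<open>r\<close>. Such defects occupy only finitely many orbits, and infinite index supplies a
  rotation in \<Lambda> that carries a given orbit to an undisturbed one. The three places of a
  switch are the break points of a partial rotation: the interior one is brought to
  \<open>x\<close>, and the ends of the interval then lie at \<open>x + s - l\<close> and
  \<open>x + s\<close>. Away from them a partial rotation is locally a translation and commutes with
  small rotations. Modulo finite sets nothing is known about the value of a lift at one given point.
  Switches probe this value, because commutation in \<open>H\<close> is an exact identity; the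
  abundance of parameters \<open>s\<close> leaves room to avoid finitely many coincidences.\<close>

definition near :: "('a \<Rightarrow> 'b) \<Rightarrow> ('a \<Rightarrow> 'b) \<Rightarrow> bool" where
  "near g h \<longleftrightarrow> finite {x. g x \<noteq> h x}"

lemma near_refl [simp]: "near g g"
  by (simp add: near_def)

lemma near_sym: "near g h \<Longrightarrow> near h g"
  by (simp add: near_def eq_commute)

lemma near_trans: "near f g \<Longrightarrow> near g h \<Longrightarrow> near f h"
  unfolding near_def by (rule finite_subset[of _ "{x. f x \<noteq> g x} \<union> {x. g x \<noteq> h x}"]) auto

lemma near_comp:
  assumes "near f f'" "near g g'" "inj g"
  shows "near (f \<circ> g) (f' \<circ> g')"
proof -
  have "{x. (f \<circ> g) x \<noteq> (f' \<circ> g') x} \<subseteq> {x. g x \<noteq> g' x} \<union> g -` {y. f y \<noteq> f' y}"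
    by auto
  moreover have "finite (g -` {y. f y \<noteq> f' y})"
    using assms by (intro finite_vimageI) (auto simp: near_def)
  ultimately show ?thesis
    using assms(2) unfolding near_def by (meson finite_UnI finite_subset)
qed

lemma near_inv:
  assumes "near g h" "bij g" "bij h"
  shows "near (inv_into UNIV g) (inv_into UNIV h)"
proof -
  have "{x. inv_into UNIV g x \<noteq> inv_into UNIV h x} \<subseteq> g ` {x. g x \<noteq> h x}"
  proof
    fix x assume x: "x \<in> {x. inv_into UNIV g x \<noteq> inv_into UNIV h x}"
    obtain y where y: "x = g y"
      using assms(2) by (metis bij_is_surj surjD)
    have "inv_into UNIV g x = y"
      using y assms(2) by (simp add: bij_is_inj)
    then have "g y \<noteq> h y"
      using x y assms(3) by (auto simp: bij_is_inj)
    then show "x \<in> g ` {x. g x \<noteq> h x}"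
      using y by blast
  qed
  then show ?thesis
    using assms(1) unfolding near_def by (meson finite_imageI finite_subset)
qed

section \<open>The circle as a quotient of the line\<close>

lemma surj_to_circle: "surj to_circle"
  by (metis Quotient_circle Quotient_abs_rep surjI)

lemma to_circle_cases: obtains t where "x = to_circle t"
  using surj_to_circle by (metis surjD)

lemma to_circle_cases_Ico:
  obtains t where "x = to_circle t" "u \<le> t" "t < u + 1"
proof -
  obtain t where t: "x = to_circle t"
    by (rule to_circle_cases)
  have "to_circle t = to_circle (u + frac (t - u))"
    unfolding to_circle_eq_iff frac_def by simp
  with t show ?thesis
    by (intro that[of "u + frac (t - u)"]) (auto simp: frac_lt_1)
qed

lemma to_circle_add: "to_circle (s + t) = to_circle s + to_circle t"
  by (simp add: plus_circle.abs_eq)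

lemma to_circle_diff: "to_circle (s - t) = to_circle s - to_circle t"
  by (simp add: minus_circle.abs_eq)

lemma to_circle_minus: "to_circle (- t) = - to_circle t"
  by (simp add: uminus_circle.abs_eq)

lemma to_circle_0 [simp]: "to_circle 0 = 0"
  by (simp add: zero_circle_def)

lemma to_circle_of_int [simp]: "to_circle (of_int n) = 0"
  using to_circle_eq_iff[of "of_int n" 0] by simp

lemma to_circle_inj_near:
  assumes "to_circle s = to_circle t" "\<bar>s - t\<bar> < 1"
  shows "s = t"
proof -
  obtain n where "s - t = of_int n"
    using assms(1) by (auto simp: to_circle_eq_iff elim: Ints_cases)
  moreover from this assms(2) have "n = 0"
    by simp
  ultimately show ?thesis by simp
qed

lemma inj_on_to_circle_Ioo: "v \<le> u + 1 \<Longrightarrow> inj_on to_circle {u<..<v}"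
  by (rule inj_onI, rule to_circle_inj_near) auto

lemma continuous_to_circle: "continuous_on UNIV to_circle"
  by (simp add: continuous_on_open_vimage open_circle_def)

lemma isCont_to_circle: "isCont to_circle t"
  using continuous_to_circle by (simp add: continuous_on_eq_continuous_at)

lemma open_vimage_to_circle: "open U \<Longrightarrow> open (to_circle -` U)"
  by (simp add: open_circle_def)

text \<open>The quotient map is open as well as continuous, so it carries neighbourhood filters to
  neighbourhood filters, and continuity on the circle can be tested on the line.\<close>

lemma nhds_to_circle: "nhds (to_circle t) = filtermap to_circle (nhds t)"
  by (rule filtermap_nhds_open_map[symmetric])
     (auto simp: isCont_to_circle open_to_circle_image)

lemma isCont_to_circle_iff:
  fixes F :: "circle \<Rightarrow> 'a :: topological_space"
  shows "isCont F (to_circle t) \<longleftrightarrow> isCont (\<lambda>u. F (to_circle u)) t"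
  unfolding isCont_def tendsto_at_iff_tendsto_nhds[of F]
    tendsto_at_iff_tendsto_nhds[of "\<lambda>u. F (to_circle u)"] nhds_to_circle filterlim_filtermap ..

lemma circle_offset_to_circle: "circle_offset a (to_circle t) = frac (t - a)"
  by (simp add: circle_offset.abs_eq)

lemma to_circle_offset: "to_circle (a + circle_offset a x) = x"
proof -
  obtain t where "x = to_circle t"
    by (rule to_circle_cases)
  then show ?thesis
    by (simp add: circle_offset_to_circle to_circle_eq_iff frac_def)
qed

lemma isCont_circle_offset:
  assumes "x \<noteq> to_circle a"
  shows "isCont (circle_offset a) x"
proof -
  obtain t where t: "x = to_circle t"
    by (rule to_circle_cases)
  then have "t - a \<notin> \<int>"
    using assms by (simp add: to_circle_eq_iff)
  moreover have "isCont (\<lambda>u. u - a) t"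
    by (intro continuous_intros)
  ultimately have "isCont (\<lambda>u. frac (u - a)) t"
    using isCont_o2[of t "\<lambda>u. u - a" frac] continuous_frac by blast
  then show ?thesis
    by (simp add: t isCont_to_circle_iff circle_offset_to_circle)
qed

section \<open>The group of piecewise continuous permutations\<close>

text \<open>Invariance of domain in dimension one: near a continuity point, a real lift of \<open>g\<close> is a
  continuous injection of an interval, hence open.\<close>

lemma isCont_inv:
  fixes g :: "circle \<Rightarrow> circle"
  assumes "bij g" and fin: "finite {x. \<not> isCont g x}" and "isCont g x"
  shows "isCont (inv_into UNIV g) (g x)"
proof -
  obtain t where t: "x = to_circle t"
    by (rule to_circle_cases)
  obtain w where w: "g x = to_circle w"
    by (rule to_circle_cases)
  \<comment> \<open>The lift is cut at the point opposite to \<open>g x\<close>, where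
    \<open>circle_offset\<close> jumps; near \<open>g x\<close> it is continuous.\<close>
  define h where "h = (\<lambda>u. w - 1/2 + circle_offset (w - 1/2) (g (to_circle u)))"
  have h: "to_circle (h u) = g (to_circle u)" for u
    by (simp add: h_def to_circle_offset)
  have "g x \<noteq> to_circle (w - 1/2)"
  proof
    assume "g x = to_circle (w - 1/2)"
    from to_circle_inj_near[OF this[unfolded w]] show False by simp
  qed
  then have "open (- {to_circle (w - 1/2)})" "g x \<in> - {to_circle (w - 1/2)}"
    by auto
  then obtain U where U: "open U" "x \<in> U" "\<forall>y\<in>U. g y \<in> - {to_circle (w - 1/2)}"
    using assms(3) unfolding continuous_at_open by blast
  \<comment> \<open>Invariance of domain needs continuity on a whole interval around
    \<open>t\<close>; finiteness of the set of discontinuities provides it.\<close>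
  have "open (- {x. \<not> isCont g x})"
    using fin by (simp add: finite_imp_closed open_Compl)
  then have "open (to_circle -` (U \<inter> - {x. \<not> isCont g x}))"
    using U(1) by (intro open_vimage_to_circle open_Int)
  moreover have "t \<in> to_circle -` (U \<inter> - {x. \<not> isCont g x})"
    using U(2) assms(3) t by auto
  ultimately obtain d where d: "d > 0" "ball t d \<subseteq> to_circle -` (U \<inter> - {x. \<not> isCont g x})"
    unfolding open_contains_ball by blast
  \<comment> \<open>At most 1/2, so that the ball spans no more than one turn and
    \<open>to_circle\<close> is injective on it.\<close>
  define r where "r = min d (1/2)"
  have "isCont h u" if "u \<in> ball t r" for u
  proof -
    from that have "u \<in> to_circle -` (U \<inter> - {x. \<not> isCont g x})"
      using d(2) by (auto simp: r_def)
    then have u: "isCont g (to_circle u)" "g (to_circle u) \<noteq> to_circle (w - 1/2)"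
      using U(3) by auto
    have "isCont (\<lambda>u. g (to_circle u)) u"
      using u(1) by (simp add: isCont_to_circle_iff)
    from isCont_o2[OF this isCont_circle_offset[OF u(2)]] show ?thesis
      unfolding h_def by (intro continuous_intros)
  qed
  then have cont: "continuous_on (ball t r) h"
    by (simp add: continuous_at_imp_continuous_on)
  have inj: "inj_on h (ball t r)"
  proof (rule inj_onI)
    fix u v assume uv: "u \<in> ball t r" "v \<in> ball t r" "h u = h v"
    then have "to_circle u = to_circle v"
      using h assms(1) by (metis bij_is_inj injD)
    moreover have "\<bar>u - v\<bar> < 1"
      using uv unfolding r_def mem_ball dist_real_def by linarith
    ultimately show "u = v"
      by (rule to_circle_inj_near)
  qed
  show ?thesis
    unfolding continuous_at_open
  proof (intro allI impI)
    fix V assume V: "open V \<and> inv_into UNIV g (g x) \<in> V"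
    then have "x \<in> V"
      using assms(1) by (simp add: bij_is_inj)
    then have "open (to_circle -` V \<inter> ball t r)" and tV: "t \<in> to_circle -` V \<inter> ball t r"
      using V d(1) by (auto simp: t r_def open_vimage_to_circle)
    then have "open (h ` (to_circle -` V \<inter> ball t r))"
      using injective_into_1d_imp_open_map_UNIV[OF _ cont inj] by blast
    then have "open (to_circle ` h ` (to_circle -` V \<inter> ball t r))"
      by (rule open_to_circle_image)
    moreover have "g x \<in> to_circle ` h ` (to_circle -` V \<inter> ball t r)"
      using tV h[of t] t by (metis imageI)
    moreover have "inv_into UNIV g y \<in> V" if "y \<in> to_circle ` h ` (to_circle -` V \<inter> ball t r)" for y
      using that h assms(1) by (auto simp: bij_is_inj)
    ultimately show "\<exists>S. open S \<and> g x \<in> S \<and> (\<forall>y\<in>S. inv_into UNIV g y \<in> V)"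
      by blast
  qed
qed

lemma isCont_near:
  fixes g h :: "circle \<Rightarrow> 'b :: topological_space"
  assumes "near g h" "isCont g x" "g x = h x"
  shows "isCont h x"
proof -
  have "open (- {y. g y \<noteq> h y})"
    using assms(1) by (simp add: near_def finite_imp_closed open_Compl)
  then have "eventually (\<lambda>y. y \<in> - {y. g y \<noteq> h y}) (nhds x)"
    using assms(3) by (intro eventually_nhds_in_open) auto
  then have "eventually (\<lambda>y. g y = h y) (nhds x)"
    by simp
  then show ?thesis
    using assms(2) isCont_cong by blast
qed

lemma in_carrier_PC_hat: "g \<in> carrier PC_hat \<longleftrightarrow> bij g \<and> finite {x. \<not> isCont g x}"
  by (simp add: PC_hat_def)

lemma mult_PC_hat [simp]: "g \<otimes>\<^bsub>PC_hat\<^esub> h = g \<circ> h"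
  by (simp add: PC_hat_def)

lemma one_PC_hat [simp]: "\<one>\<^bsub>PC_hat\<^esub> = id"
  by (simp add: PC_hat_def)

lemma inv_in_PC_hat:
  assumes "g \<in> carrier PC_hat"
  shows "inv_into UNIV g \<in> carrier PC_hat"
proof -
  have "{y. \<not> isCont (inv_into UNIV g) y} \<subseteq> g ` {x. \<not> isCont g x}"
  proof
    fix y assume "y \<in> {y. \<not> isCont (inv_into UNIV g) y}"
    moreover have "y = g (inv_into UNIV g y)"
      using assms by (simp add: in_carrier_PC_hat bij_is_surj surj_f_inv_f)
    ultimately show "y \<in> g ` {x. \<not> isCont g x}"
      using isCont_inv[of g "inv_into UNIV g y"] assms by (auto simp: in_carrier_PC_hat)
  qed
  then show ?thesis
    using assms by (auto simp: in_carrier_PC_hat bij_imp_bij_inv intro: finite_subset)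
qed

lemma comp_in_PC_hat:
  assumes "g \<in> carrier PC_hat" "h \<in> carrier PC_hat"
  shows "g \<circ> h \<in> carrier PC_hat"
proof -
  have "{x. \<not> isCont (g \<circ> h) x} \<subseteq> {x. \<not> isCont h x} \<union> h -` {x. \<not> isCont g x}"
    using isCont_o2[of _ h g] by (auto simp: comp_def)
  moreover have "finite (h -` {x. \<not> isCont g x})"
    using assms by (intro finite_vimageI) (auto simp: in_carrier_PC_hat bij_is_inj)
  ultimately show ?thesis
    using assms by (auto simp: in_carrier_PC_hat bij_comp intro: finite_subset)
qed

interpretation PC_hat: group PC_hat
proof (rule groupI)
  show "\<exists>y\<in>carrier PC_hat. y \<otimes>\<^bsub>PC_hat\<^esub> x = \<one>\<^bsub>PC_hat\<^esub>" if "x \<in> carrier PC_hat" for x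
    using that inv_in_PC_hat[OF that]
    by (intro bexI[of _ "inv_into UNIV x"]) (auto simp: in_carrier_PC_hat bij_is_inj)
  show "\<one>\<^bsub>PC_hat\<^esub> \<in> carrier PC_hat"
    by (simp add: in_carrier_PC_hat)
qed (simp_all add: comp_in_PC_hat comp_assoc)

lemma m_inv_PC_hat:
  assumes "g \<in> carrier PC_hat"
  shows "inv\<^bsub>PC_hat\<^esub> g = inv_into UNIV g"
  by (rule group.inv_equality[OF PC_hat.is_group])
     (use assms inv_in_PC_hat[OF assms] in \<open>simp_all add: in_carrier_PC_hat[of g] bij_is_inj\<close>)

lemma fin_supp_perms_iff: "g \<in> fin_supp_perms \<longleftrightarrow> bij g \<and> near g id"
  by (simp add: fin_supp_perms_def near_def)

lemma in_carrier_PC_hat_near: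
  assumes "g \<in> carrier PC_hat" "near g h" "bij h"
  shows "h \<in> carrier PC_hat"
proof -
  have "{x. \<not> isCont h x} \<subseteq> {x. \<not> isCont g x} \<union> {x. g x \<noteq> h x}"
    using isCont_near[OF assms(2)] by auto
  then show ?thesis
    using assms by (auto simp: in_carrier_PC_hat near_def intro: finite_subset)
qed

lemma fin_supp_perms_subset: "fin_supp_perms \<subseteq> carrier PC_hat"
  using in_carrier_PC_hat_near[OF PC_hat.one_closed] near_sym
  by (auto simp: fin_supp_perms_iff) blast

lemma fin_supp_perms_normal: "fin_supp_perms \<lhd> PC_hat"
proof -
  have "subgroup fin_supp_perms PC_hat"
  proof (rule PC_hat.subgroupI)
    show "fin_supp_perms \<noteq> {}"
      using near_refl by (metis bij_id empty_iff fin_supp_perms_iff)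
    show "inv\<^bsub>PC_hat\<^esub> g \<in> fin_supp_perms" if "g \<in> fin_supp_perms" for g
      using that fin_supp_perms_subset near_inv[of g id]
      by (auto simp: m_inv_PC_hat fin_supp_perms_iff bij_imp_bij_inv subset_iff)
    show "g \<otimes>\<^bsub>PC_hat\<^esub> h \<in> fin_supp_perms" if "g \<in> fin_supp_perms" "h \<in> fin_supp_perms" for g h
      using that near_comp[of g id h id] by (auto simp: fin_supp_perms_iff bij_comp bij_is_inj)
  qed (fact fin_supp_perms_subset)
  moreover have "x \<circ> h \<circ> inv_into UNIV x \<in> fin_supp_perms" if "x \<in> carrier PC_hat" "h \<in> fin_supp_perms" for x h
  proof -
    have "bij x" "bij h" "near h id"
      using that by (auto simp: in_carrier_PC_hat fin_supp_perms_iff)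
    then have "near (x \<circ> h \<circ> inv_into UNIV x) (x \<circ> id \<circ> inv_into UNIV x)"
      by (intro near_comp) (auto simp: bij_is_inj bij_imp_bij_inv)
    with \<open>bij x\<close> \<open>bij h\<close> show ?thesis
      by (simp add: fin_supp_perms_iff bij_comp bij_imp_bij_inv bij_is_surj surj_iff[THEN iffD1])
  qed
  ultimately show ?thesis
    by (simp add: PC_hat.normal_inv_iff m_inv_PC_hat)
qed

interpretation fin_supp_perms: normal fin_supp_perms PC_hat
  by (rule fin_supp_perms_normal)

interpretation PC: group PC
  unfolding PC_def by (rule fin_supp_perms.factorgroup_is_group)

lemma proj_PC_hom: "proj_PC \<in> hom PC_hat PC"
  unfolding PC_def proj_PC_def by (rule fin_supp_perms.r_coset_hom_Mod)

lemma proj_PC_comp: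
  "g \<in> carrier PC_hat \<Longrightarrow> h \<in> carrier PC_hat \<Longrightarrow> proj_PC (g \<circ> h) = proj_PC g \<otimes>\<^bsub>PC\<^esub> proj_PC h"
  using hom_mult[OF proj_PC_hom] by simp

lemma one_PC: "\<one>\<^bsub>PC\<^esub> = proj_PC id"
  using hom_one[OF proj_PC_hom PC_hat.is_group PC.is_group] by simp

lemma in_proj_PC_iff:
  assumes "g \<in> carrier PC_hat"
  shows "h \<in> proj_PC g \<longleftrightarrow> bij h \<and> near h g"
proof
  assume "h \<in> proj_PC g"
  then obtain k where k: "k \<in> fin_supp_perms" "h = k \<circ> g"
    by (auto simp: proj_PC_def r_coset_def)
  then show "bij h \<and> near h g"
    using near_comp[of k id g g] assms
    by (auto simp: fin_supp_perms_iff in_carrier_PC_hat bij_comp bij_is_inj)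
next
  assume h: "bij h \<and> near h g"
  have g: "bij g"
    using assms by (simp add: in_carrier_PC_hat)
  have "near (h \<circ> inv_into UNIV g) (g \<circ> inv_into UNIV g)"
    using h g by (intro near_comp) (auto simp: bij_imp_bij_inv bij_is_inj)
  then have "h \<circ> inv_into UNIV g \<in> fin_supp_perms"
    using h g by (simp add: fin_supp_perms_iff bij_comp bij_imp_bij_inv bij_is_surj surj_iff[THEN iffD1])
  moreover have "h = (h \<circ> inv_into UNIV g) \<circ> g"
    using g by (auto simp: bij_is_inj fun_eq_iff)
  ultimately show "h \<in> proj_PC g"
    by (auto simp: proj_PC_def r_coset_def)
qed

lemma proj_PC_eq_iff:
  assumes "g \<in> carrier PC_hat" "h \<in> carrier PC_hat"
  shows "proj_PC g = proj_PC h \<longleftrightarrow> near g h"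
proof
  have "g \<in> proj_PC g"
    using assms by (simp add: in_proj_PC_iff in_carrier_PC_hat)
  then show "near g h" if "proj_PC g = proj_PC h"
    using that assms by (simp add: in_proj_PC_iff)
  show "proj_PC g = proj_PC h" if "near g h"
    using assms that by (auto simp: in_proj_PC_iff set_eq_iff intro: near_trans dest: near_sym)
qed

lemma rotation_in_PC_hat: "rotation t \<in> carrier PC_hat"
proof -
  have "bij (rotation t)"
    by (rule bij_betw_byWitness[of _ "rotation (- t)"]) (auto simp: rotation_def)
  moreover have "isCont (rotation t) x" for x
  proof -
    obtain u v where "x = to_circle u" "t = to_circle v"
      using to_circle_cases by metis
    then show ?thesis
      unfolding rotation_def
      by (simp add: isCont_to_circle_iff flip: to_circle_add)
         (rule isCont_o2[OF _ isCont_to_circle], intro continuous_intros)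
  qed
  ultimately show ?thesis
    by (simp add: in_carrier_PC_hat)
qed

lemma rotation_add: "rotation (s + t) = rotation s \<circ> rotation t"
  by (auto simp: rotation_def fun_eq_iff algebra_simps)

lemma rotation_0: "rotation 0 = id"
  by (auto simp: rotation_def)

section \<open>The rational rank of an abelian group\<close>

context comm_group
begin

abbreviation tensor_free :: "('a \<times> rat \<Rightarrow>\<^sub>0 int) monoid" where
  "tensor_free \<equiv> free_Abelian_group (carrier G \<times> UNIV)"

abbreviation tensor_rels :: "('a \<times> rat \<Rightarrow>\<^sub>0 int) set" where
  "tensor_rels \<equiv> generate tensor_free (tensor_rat_rels G)"

definition tensor_class :: "('a \<times> rat \<Rightarrow>\<^sub>0 int) \<Rightarrow> ('a \<times> rat \<Rightarrow>\<^sub>0 int) set" where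
  "tensor_class w = tensor_rels #>\<^bsub>tensor_free\<^esub> w"

definition tensor_scale :: "rat \<Rightarrow> ('a \<times> rat \<Rightarrow>\<^sub>0 int) \<Rightarrow> ('a \<times> rat \<Rightarrow>\<^sub>0 int)" where
  "tensor_scale q = frag_extend (\<lambda>(a, r). frag_of (a, q * r))"

lemma tensor_rat_rels_subset: "tensor_rat_rels G \<subseteq> carrier tensor_free"
proof -
  have diff: "x - y \<in> carrier tensor_free" if "x \<in> carrier tensor_free" "y \<in> carrier tensor_free"
    for x y :: "'a \<times> rat \<Rightarrow>\<^sub>0 int"
    using that keys_diff[of x y] by auto
  show ?thesis
    unfolding tensor_rat_rels_def by (auto simp del: carrier_free_Abelian_group_iff intro!: diff)
qed

lemma subgroup_tensor_rels: "subgroup tensor_rels tensor_free"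
  by (rule group.generate_is_subgroup[OF group_free_Abelian_group tensor_rat_rels_subset])

lemma tensor_rels_subset: "tensor_rels \<subseteq> carrier tensor_free"
  by (rule subgroup.subset[OF subgroup_tensor_rels])

lemma tensor_rels_zero: "0 \<in> tensor_rels"
  using subgroup.one_closed[OF subgroup_tensor_rels] by simp

lemma tensor_rels_add: "x \<in> tensor_rels \<Longrightarrow> y \<in> tensor_rels \<Longrightarrow> x + y \<in> tensor_rels"
  using subgroup.m_closed[OF subgroup_tensor_rels] by simp

lemma tensor_rels_minus: "x \<in> tensor_rels \<Longrightarrow> - x \<in> tensor_rels"
  using subgroup.m_inv_closed[OF subgroup_tensor_rels, of x] subsetD[OF tensor_rels_subset, of x]
  by simp

lemma tensor_rels_diff: "x \<in> tensor_rels \<Longrightarrow> y \<in> tensor_rels \<Longrightarrow> x - y \<in> tensor_rels"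
  using tensor_rels_add[of x "- y"] tensor_rels_minus[of y] by simp

lemma tensor_rels_mult:
  assumes "a \<in> carrier G" "b \<in> carrier G"
  shows "frag_of (a \<otimes> b, q) - frag_of (a, q) - frag_of (b, q) \<in> tensor_rels"
  by (rule generate.incl) (use assms in \<open>auto simp: tensor_rat_rels_def\<close>)

lemma tensor_rels_plus:
  assumes "a \<in> carrier G"
  shows "frag_of (a, q + r) - frag_of (a, q) - frag_of (a, r) \<in> tensor_rels"
  by (rule generate.incl) (use assms in \<open>unfold tensor_rat_rels_def, blast\<close>)

lemma tensor_rels_normal: "tensor_rels \<lhd> tensor_free"
  using comm_group.normal_iff_subgroup[OF abelian_free_Abelian_group] subgroup_tensor_rels by blast

lemma tensor_class_eq: "tensor_class w = (\<lambda>r. r + w) ` tensor_rels"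
  by (auto simp: tensor_class_def r_coset_def)

lemma tensor_class_eq_iff: "tensor_class w = tensor_class w' \<longleftrightarrow> w - w' \<in> tensor_rels"
proof
  assume "tensor_class w = tensor_class w'"
  moreover have "w \<in> tensor_class w"
    unfolding tensor_class_eq by (rule image_eqI[OF _ tensor_rels_zero]) simp
  ultimately show "w - w' \<in> tensor_rels"
    by (auto simp: tensor_class_eq)
next
  assume w: "w - w' \<in> tensor_rels"
  show "tensor_class w = tensor_class w'"
    unfolding tensor_class_eq
  proof (intro equalityI subsetI; elim imageE)
    show "x \<in> (\<lambda>r. r + w') ` tensor_rels" if "x = r + w" "r \<in> tensor_rels" for x r
      using tensor_rels_add[OF that(2) w] that(1) by (intro image_eqI[of _ _ "r + (w - w')"]) auto
    show "x \<in> (\<lambda>r. r + w) ` tensor_rels" if "x = r + w'" "r \<in> tensor_rels" for x r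
      using tensor_rels_diff[OF that(2) w] that(1) by (intro image_eqI[of _ _ "r - (w - w')"]) auto
  qed
qed

lemma tensor_rat_group_eq: "tensor_rat_group G = tensor_free Mod tensor_rels"
  by (simp add: tensor_rat_group_def Let_def)

lemma carrier_tensor_rat: "carrier (tensor_rat G) = tensor_class ` carrier tensor_free"
  by (simp add: tensor_rat_def tensor_rat_group_eq carrier_FactGroup tensor_class_def[abs_def])

lemma zero_tensor_rat: "\<zero>\<^bsub>tensor_rat G\<^esub> = tensor_class 0"
  by (simp add: tensor_rat_def tensor_rat_group_eq tensor_class_eq)

lemma add_tensor_rat:
  assumes "w \<in> carrier tensor_free" "w' \<in> carrier tensor_free"
  shows "tensor_class w \<oplus>\<^bsub>tensor_rat G\<^esub> tensor_class w' = tensor_class (w + w')"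
  using normal.rcos_sum[OF tensor_rels_normal assms]
  by (simp add: tensor_rat_def tensor_rat_group_eq tensor_class_def)

lemma tensor_scale_of [simp]: "tensor_scale q (frag_of (a, r)) = frag_of (a, q * r)"
  by (simp add: tensor_scale_def)

lemma tensor_scale_simps [simp]:
  "tensor_scale q 0 = 0"
  "tensor_scale q (x + y) = tensor_scale q x + tensor_scale q y"
  "tensor_scale q (x - y) = tensor_scale q x - tensor_scale q y"
  "tensor_scale q (- x) = - tensor_scale q x"
  by (simp_all add: tensor_scale_def frag_extend_add frag_extend_diff frag_extend_minus)

lemma tensor_scale_closed:
  assumes "w \<in> carrier tensor_free"
  shows "tensor_scale q w \<in> carrier tensor_free"
proof -
  have "Poly_Mapping.keys (tensor_scale q w) \<subseteq>
      (\<Union>x\<in>Poly_Mapping.keys w. Poly_Mapping.keys ((\<lambda>(a, r). frag_of (a, q * r)) x))"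
    unfolding tensor_scale_def by (rule keys_frag_extend)
  then show ?thesis
    using assms by fastforce
qed

text \<open>Both families of defining relations are stable under multiplying the rational entry by
  \<open>q\<close>; this lets the scalar action descend to cosets.\<close>

lemma tensor_scale_rels:
  assumes "x \<in> tensor_rels"
  shows "tensor_scale q x \<in> tensor_rels"
proof -
  have rel: "tensor_scale q h \<in> tensor_rels" if "h \<in> tensor_rat_rels G" for h
  proof -
    from that consider a b p where "a \<in> carrier G" "b \<in> carrier G"
        "h = frag_of (a \<otimes> b, p) - frag_of (a, p) - frag_of (b, p)"
      | a p r where "a \<in> carrier G" "h = frag_of (a, p + r) - frag_of (a, p) - frag_of (a, r)"
      unfolding tensor_rat_rels_def by blast
    then show ?thesis
      by cases (simp_all only: tensor_scale_simps tensor_scale_of distrib_left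
          tensor_rels_mult tensor_rels_plus)
  qed
  show ?thesis
    using assms
  proof induction
    case one
    then show ?case by (simp add: tensor_rels_zero)
  next
    case (incl h)
    then show ?case by (rule rel)
  next
    case (inv h)
    then have "inv\<^bsub>tensor_free\<^esub> h = - h"
      using subsetD[OF tensor_rat_rels_subset, of h] by simp
    then show ?case
      using rel[OF inv] by (simp add: tensor_rels_minus)
  next
    case (eng h1 h2)
    then show ?case by (simp add: tensor_rels_add)
  qed
qed

text \<open>Any representative of the coset may be scaled: a change of representative scales to a
  relation, and the factor of relations in the definition absorbs it.\<close>

lemma smult_tensor_rat:
  "q \<odot>\<^bsub>tensor_rat G\<^esub> tensor_class w = tensor_class (tensor_scale q w)"
proof -
  have "q \<odot>\<^bsub>tensor_rat G\<^esub> tensor_class w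
      = tensor_rels <#>\<^bsub>tensor_free\<^esub> tensor_scale q ` tensor_class w"
    by (simp add: tensor_rat_def tensor_rat_group_eq tensor_scale_def)
  also have "\<dots> = tensor_class (tensor_scale q w)"
    unfolding tensor_class_eq set_mult_def
  proof (intro equalityI subsetI)
    fix x assume "x \<in> (\<Union>h\<in>tensor_rels. \<Union>k\<in>tensor_scale q ` (\<lambda>r. r + w) ` tensor_rels.
        {h \<otimes>\<^bsub>tensor_free\<^esub> k})"
    then obtain h r where "h \<in> tensor_rels" "r \<in> tensor_rels" "x = (h + tensor_scale q r) + tensor_scale q w"
      by (auto simp: add.assoc)
    then show "x \<in> (\<lambda>r. r + tensor_scale q w) ` tensor_rels"
      using tensor_rels_add tensor_scale_rels by blast
  next
    fix x assume "x \<in> (\<lambda>r. r + tensor_scale q w) ` tensor_rels"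
    then obtain r where "r \<in> tensor_rels" "x = r + tensor_scale q (0 + w)"
      by auto
    then show "x \<in> (\<Union>h\<in>tensor_rels. \<Union>k\<in>tensor_scale q ` (\<lambda>r. r + w) ` tensor_rels.
        {h \<otimes>\<^bsub>tensor_free\<^esub> k})"
      using tensor_rels_zero by (fastforce simp del: add_0)
  qed
  finally show ?thesis .
qed

text \<open>Among the laws for scalars this is the one that needs the relations; the others hold
  already in the free group. On generators it is the second family of relations, and both sides are
  additive in \<open>w\<close>.\<close>

lemma tensor_scale_add_rat:
  assumes "w \<in> carrier tensor_free"
  shows "tensor_scale (q + r) w - (tensor_scale q w + tensor_scale r w) \<in> tensor_rels"
proof -
  have "Poly_Mapping.keys w \<subseteq> carrier G \<times> UNIV"
    using assms by simp
  then show ?thesis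
  proof (rule free_Abelian_group_induct)
    show "tensor_scale (q + r) 0 - (tensor_scale q 0 + tensor_scale r 0) \<in> tensor_rels"
      by (simp add: tensor_rels_zero)
  next
    fix x y
    assume "tensor_scale (q + r) x - (tensor_scale q x + tensor_scale r x) \<in> tensor_rels"
      "tensor_scale (q + r) y - (tensor_scale q y + tensor_scale r y) \<in> tensor_rels"
    moreover have "tensor_scale (q + r) (x - y) - (tensor_scale q (x - y) + tensor_scale r (x - y))
        = (tensor_scale (q + r) x - (tensor_scale q x + tensor_scale r x))
          - (tensor_scale (q + r) y - (tensor_scale q y + tensor_scale r y))"
      by (simp add: algebra_simps)
    ultimately show "tensor_scale (q + r) (x - y) - (tensor_scale q (x - y) + tensor_scale r (x - y))
        \<in> tensor_rels"
      using tensor_rels_diff by metis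
  next
    fix a :: "'a \<times> rat"
    assume "a \<in> carrier G \<times> UNIV"
    then obtain b p where a: "a = (b, p)" "b \<in> carrier G"
      by auto
    then show "tensor_scale (q + r) (frag_of a) - (tensor_scale q (frag_of a) + tensor_scale r (frag_of a))
        \<in> tensor_rels"
      using tensor_rels_plus[OF a(2), of "q * p" "r * p"] by (simp add: distrib_right diff_diff_eq)
  qed
qed

lemma tensor_scale_mult: "tensor_scale q (tensor_scale r w) = tensor_scale (q * r) w"
  by (rule frag_induction[of w UNIV]) (auto simp: mult.assoc)

lemma tensor_scale_1: "tensor_scale 1 w = w"
  by (rule frag_induction[of w UNIV]) auto

lemma vectorspace_tensor_rat: "vectorspace class_ring (tensor_rat G)"
proof -
  have carrier_add: "w + w' \<in> carrier tensor_free"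
    if "w \<in> carrier tensor_free" "w' \<in> carrier tensor_free" for w w' :: "'a \<times> rat \<Rightarrow>\<^sub>0 int"
    using that keys_add[of w w'] by auto
  have scale_add: "tensor_class (tensor_scale (q + r) w) = tensor_class (tensor_scale q w + tensor_scale r w)"
    if "w \<in> carrier tensor_free" for q r w
    using tensor_scale_add_rat[OF that] by (simp add: tensor_class_eq_iff)
  have zero: "0 \<in> carrier tensor_free"
    by simp
  have abelian: "abelian_group (tensor_rat G)"
  proof (rule abelian_groupI)
    show "\<exists>y\<in>carrier (tensor_rat G). y \<oplus>\<^bsub>tensor_rat G\<^esub> x = \<zero>\<^bsub>tensor_rat G\<^esub>"
      if "x \<in> carrier (tensor_rat G)" for x
    proof -
      obtain w where w: "w \<in> carrier tensor_free" "x = tensor_class w"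
        using \<open>x \<in> _\<close> by (auto simp: carrier_tensor_rat)
      then have "- w \<in> carrier tensor_free"
        by simp
      with w show ?thesis
        unfolding carrier_tensor_rat zero_tensor_rat
        by (intro bexI[of _ "tensor_class (- w)"]) (auto simp: add_tensor_rat)
    qed
  qed (auto simp: carrier_tensor_rat add_tensor_rat zero_tensor_rat zero carrier_add add_ac
      simp del: carrier_free_Abelian_group_iff)
  have "module class_ring (tensor_rat G)"
  proof (rule module.intro)
    show "cring (class_ring :: rat ring)"
      by (rule class_cring.is_cring)
    show "module_axioms class_ring (tensor_rat G)"
      by unfold_locales
         (auto simp: carrier_tensor_rat smult_tensor_rat add_tensor_rat tensor_scale_closed
            scale_add tensor_scale_mult tensor_scale_1
            simp del: carrier_free_Abelian_group_iff)
  qed (rule abelian)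
  then show ?thesis
    by (simp add: vectorspace_def class_field)
qed

text \<open>\<open>V.dim\<close> is the least size of a finite spanning set, so a spanning set
  bounds the rank directly, without the choice of a basis.\<close>

lemma Q_rank_le_card:
  assumes "finite X" "X \<subseteq> carrier (tensor_rat G)"
    and "LinearCombinations.module.span class_ring (tensor_rat G) X = carrier (tensor_rat G)"
  shows "Q_rank G \<le> enat (card X)"
proof -
  interpret V: vectorspace class_ring "tensor_rat G"
    by (rule vectorspace_tensor_rat)
  have "V.fin_dim"
    unfolding V.fin_dim_def using assms by blast
  moreover have "V.dim \<le> card X"
    unfolding V.dim_def by (rule Least_le) (use assms in blast)
  ultimately show ?thesis
    by (simp add: Q_rank_def)
qed

section \<open>Rank bounds for groups commensurable with a cyclic group\<close>

lemma tensor_rels_one: "frag_of (\<one>, q) \<in> tensor_rels"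
  using tensor_rels_minus[OF tensor_rels_mult[of \<one> \<one> q]] by simp

lemma tensor_class_rat_zero: "a \<in> carrier G \<Longrightarrow> frag_of (a, 0) \<in> tensor_rels"
  using tensor_rels_minus[OF tensor_rels_plus[of a 0 0]] by simp

lemma tensor_class_pow:
  assumes "a \<in> carrier G"
  shows "tensor_class (frag_of (a [^] (n::nat), q)) = tensor_class (frag_of (a, of_nat n * q))"
  unfolding tensor_class_eq_iff
proof (induction n)
  case 0
  then show ?case
    using tensor_rels_diff[OF tensor_rels_one tensor_class_rat_zero[OF assms]] by simp
next
  case (Suc n)
  have "frag_of (a [^] Suc n, q) - frag_of (a, of_nat (Suc n) * q)
      = (frag_of (a [^] n \<otimes> a, q) - frag_of (a [^] n, q) - frag_of (a, q))
        - (frag_of (a, of_nat n * q + q) - frag_of (a, of_nat n * q) - frag_of (a, q))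
        + (frag_of (a [^] n, q) - frag_of (a, of_nat n * q))"
    by (simp add: algebra_simps)
  then show ?case
    using assms by (metis Suc.IH nat_pow_closed tensor_rels_add tensor_rels_diff tensor_rels_mult
        tensor_rels_plus)
qed

lemma tensor_class_int_pow:
  assumes "a \<in> carrier G"
  shows "tensor_class (frag_of (a [^] (k::int), q)) = tensor_class (frag_of (a, of_int k * q))"
proof (cases k rule: int_cases4)
  case (nonneg n)
  then show ?thesis
    using tensor_class_pow[OF assms, of n q] by (simp add: int_pow_int)
next
  case (neg n)
  define b where "b = a [^] n"
  have b: "b \<in> carrier G" "a [^] k = inv b"
    using assms by (simp_all add: b_def neg int_pow_neg_int)
  have 1: "frag_of (b, q) - frag_of (a, of_nat n * q) \<in> tensor_rels"
    using tensor_class_pow[OF assms, of n q] by (simp add: b_def tensor_class_eq_iff)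
  have 2: "frag_of (\<one>, q) - frag_of (b, q) - frag_of (inv b, q) \<in> tensor_rels"
    using tensor_rels_mult[of b "inv b" q] b by simp
  have 3: "frag_of (a, 0) - frag_of (a, of_nat n * q) - frag_of (a, - (of_nat n * q)) \<in> tensor_rels"
    using tensor_rels_plus[OF assms, of "of_nat n * q" "- (of_nat n * q)"] by simp
  have 4: "frag_of (\<one>, q) - frag_of (a, 0) \<in> tensor_rels"
    using tensor_rels_one tensor_class_rat_zero[OF assms] by (rule tensor_rels_diff)
  show ?thesis
    using tensor_rels_add[OF tensor_rels_diff[OF tensor_rels_diff[OF 3 2] 1] 4]
    unfolding tensor_class_eq_iff b(2) by (simp add: neg algebra_simps)
qed

text \<open>If the \<open>n\<close>-th power of \<open>b\<close> is the \<open>k\<close>-th power of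
  \<open>a\<close>, then moving a factor \<open>n\<close> across the tensor sign turns the class of
  \<open>(b, p)\<close> into that of \<open>(a, k * p / n)\<close>. Classes of this form are closed
  under differences.\<close>

lemma tensor_class_commensurable:
  assumes a: "a \<in> carrier G"
    and dep: "\<And>x. x \<in> carrier G \<Longrightarrow> \<exists>(n::nat)>0. \<exists>k::int. x [^] n = a [^] k"
    and w: "w \<in> carrier tensor_free"
  shows "\<exists>q. tensor_class w = tensor_class (frag_of (a, q))"
proof -
  have "Poly_Mapping.keys w \<subseteq> carrier G \<times> UNIV"
    using w by simp
  then show ?thesis
  proof (rule free_Abelian_group_induct)
    show "\<exists>q. tensor_class 0 = tensor_class (frag_of (a, q))"
      using tensor_rels_minus[OF tensor_class_rat_zero[OF a]]
      by (auto simp: tensor_class_eq_iff intro!: exI[of _ 0])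
  next
    fix x y
    assume "\<exists>q. tensor_class x = tensor_class (frag_of (a, q))"
      "\<exists>q. tensor_class y = tensor_class (frag_of (a, q))"
    then obtain q r where 1: "x - frag_of (a, q) \<in> tensor_rels"
      and 2: "y - frag_of (a, r) \<in> tensor_rels"
      by (auto simp: tensor_class_eq_iff)
    have 3: "frag_of (a, q) - frag_of (a, q - r) - frag_of (a, r) \<in> tensor_rels"
      using tensor_rels_plus[OF a, of "q - r" r] by simp
    have "(x - y) - frag_of (a, q - r) \<in> tensor_rels"
      using tensor_rels_add[OF tensor_rels_diff[OF 1 2] 3] by (simp add: algebra_simps)
    then show "\<exists>q. tensor_class (x - y) = tensor_class (frag_of (a, q))"
      unfolding tensor_class_eq_iff by blast
  next
    fix u :: "'a \<times> rat"
    assume "u \<in> carrier G \<times> UNIV"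
    then obtain b p where u: "u = (b, p)" "b \<in> carrier G"
      by auto
    obtain n :: nat and k :: int where nk: "n > 0" "b [^] n = a [^] k"
      using dep[OF u(2)] by blast
    have "tensor_class (frag_of (b, p)) = tensor_class (frag_of (b [^] n, p / of_nat n))"
      using nk(1) tensor_class_pow[OF u(2), of n "p / of_nat n"] by simp
    also have "\<dots> = tensor_class (frag_of (a, of_int k * (p / of_nat n)))"
      unfolding nk(2) by (rule tensor_class_int_pow[OF a])
    finally show "\<exists>q. tensor_class (frag_of u) = tensor_class (frag_of (a, q))"
      unfolding u(1) by blast
  qed
qed

lemma Q_rank_le_1:
  assumes a: "a \<in> carrier G"
    and dep: "\<And>x. x \<in> carrier G \<Longrightarrow> \<exists>(n::nat)>0. \<exists>k::int. x [^] n = a [^] k"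
  shows "Q_rank G \<le> 1"
proof -
  interpret V: vectorspace class_ring "tensor_rat G"
    by (rule vectorspace_tensor_rat)
  define v where "v = tensor_class (frag_of (a, 1))"
  have v: "v \<in> carrier (tensor_rat G)"
    unfolding v_def carrier_tensor_rat by (rule imageI) (simp add: a)
  have "carrier (tensor_rat G) \<subseteq> V.span {v}"
  proof
    fix x assume x: "x \<in> carrier (tensor_rat G)"
    then obtain w where "w \<in> carrier tensor_free" "x = tensor_class w"
      by (auto simp: carrier_tensor_rat)
    then obtain q where q: "x = tensor_class (frag_of (a, q))"
      using tensor_class_commensurable[OF a dep] by blast
    then have "x = q \<odot>\<^bsub>tensor_rat G\<^esub> v"
      by (simp add: v_def smult_tensor_rat)
    moreover have "q \<odot>\<^bsub>tensor_rat G\<^esub> v \<in> V.span {v}"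
      using V.span_is_submodule[of "{v}"] v V.in_own_span[of "{v}"]
      by (intro submodule.smult_closed) auto
    ultimately show "x \<in> V.span {v}"
      by simp
  qed
  then have "V.span {v} = carrier (tensor_rat G)"
    using V.span_is_subset2[of "{v}"] v by auto
  then show ?thesis
    using Q_rank_le_card[of "{v}"] v by (simp add: one_enat_def)
qed

text \<open>Torsion is commensurability with \<open>\<one>\<close>: every class reduces to that of
  some \<open>(\<one>, q)\<close>, and these vanish.\<close>

lemma Q_rank_torsion:
  assumes "\<And>x. x \<in> carrier G \<Longrightarrow> \<exists>(n::nat)>0. x [^] n = \<one>"
  shows "Q_rank G = 0"
proof -
  interpret V: vectorspace class_ring "tensor_rat G"
    by (rule vectorspace_tensor_rat)
  have "carrier (tensor_rat G) \<subseteq> V.span {}"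
  proof
    fix x assume x: "x \<in> carrier (tensor_rat G)"
    then obtain w where "w \<in> carrier tensor_free" "x = tensor_class w"
      by (auto simp: carrier_tensor_rat)
    then obtain q where "x = tensor_class (frag_of (\<one>, q))"
      using tensor_class_commensurable[of \<one>] assms by (metis int_pow_one one_closed)
    also have "\<dots> = \<zero>\<^bsub>tensor_rat G\<^esub>"
      by (simp add: zero_tensor_rat tensor_class_eq_iff tensor_rels_one)
    finally show "x \<in> V.span {}"
      by (simp add: V.span_empty)
  qed
  then have "V.span {} = carrier (tensor_rat G)"
    using V.span_is_subset2[of "{}"] by auto
  then show ?thesis
    using Q_rank_le_card[of "{}"] by (simp flip: zero_enat_def)
qed

text \<open>Covering the group by finitely many cosets of \<open>\<langle>a\<rangle>\<close> would make it
  finitely generated and, by pigeonhole, of rank at most one.\<close>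

lemma infinite_index_of_Q_rank:
  assumes "Q_rank G \<ge> 2 \<or> \<not> finitely_generated G \<and> Q_rank G = 1"
  obtains a where "a \<in> carrier G" "\<And>n::nat. n > 0 \<Longrightarrow> a [^] n \<noteq> \<one>"
    "\<And>X. finite X \<Longrightarrow> X \<subseteq> carrier G \<Longrightarrow> \<exists>x\<in>carrier G. \<forall>y\<in>X. \<forall>k::int. x \<noteq> y \<otimes> a [^] k"
proof -
  have "Q_rank G \<noteq> 0"
    using assms by auto
  \<comment> \<open>Any element of infinite order serves: whichever is taken, finite index of its
    powers would bound the rank by one.\<close>
  then obtain a where a: "a \<in> carrier G" "\<And>n::nat. n > 0 \<Longrightarrow> a [^] n \<noteq> \<one>"
    using Q_rank_torsion by blast
  have "\<exists>x\<in>carrier G. \<forall>y\<in>X. \<forall>k::int. x \<noteq> y \<otimes> a [^] k"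
    if X: "finite X" "X \<subseteq> carrier G" for X
  proof (rule ccontr)
    assume neg: "\<not> ?thesis"
    have cover: "\<exists>y\<in>X. \<exists>k::int. x = y \<otimes> a [^] k" if "x \<in> carrier G" for x
      using neg that by blast
    have "finitely_generated G"
      unfolding finitely_generated_def
    proof (intro exI conjI)
      show "finite (insert a X)" "insert a X \<subseteq> carrier G"
        using X a by auto
      have sub: "subgroup (generate G (insert a X)) G"
        using X a by (intro generate_is_subgroup) auto
      show "generate G (insert a X) = carrier G"
      proof (intro equalityI subsetI)
        fix x assume "x \<in> carrier G"
        then obtain y k where y: "y \<in> X" and x: "x = y \<otimes> a [^] (k::int)"
          using cover by blast
        have "y \<in> generate G (insert a X)" "a \<in> generate G (insert a X)"
          using y by (auto intro: generate.incl)
        then show "x \<in> generate G (insert a X)"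
          unfolding x using sub by (intro subgroup.m_closed subgroup_int_pow_closed)
      qed (use subgroup.subset[OF sub] in blast)
    qed
    moreover have "Q_rank G \<le> 1"
    proof (rule Q_rank_le_1[OF a(1)])
      fix x assume x: "x \<in> carrier G"
      have "\<forall>n::nat. \<exists>y\<in>X. \<exists>k::int. x [^] n = y \<otimes> a [^] k"
        using cover x by simp
      then obtain f where f: "\<And>n::nat. f n \<in> X \<and> (\<exists>k::int. x [^] n = f n \<otimes> a [^] k)"
        by metis
      have "\<not> inj f"
        using f X(1) by (metis image_subsetI infinite_UNIV_nat inj_on_finite)
      then obtain m n where mn: "m < n" "f m = f n"
        by (metis inj_onI linorder_neqE_nat)
      obtain k l :: int where kl: "x [^] m = f n \<otimes> a [^] k" "x [^] n = f n \<otimes> a [^] l"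
        using f[of m] f[of n] mn(2) by auto
      have fn: "f n \<in> carrier G"
        using f X(2) by blast
      have "x [^] m \<otimes> x [^] (n - m) = x [^] n"
        using x mn(1) by (simp add: nat_pow_mult)
      also have "\<dots> = x [^] m \<otimes> a [^] (l - k)"
        using fn a(1) by (simp add: kl m_assoc flip: int_pow_mult)
      finally have "x [^] (n - m) = a [^] (l - k)"
        using x a(1) by simp
      then show "\<exists>(n::nat)>0. \<exists>k::int. x [^] n = a [^] k"
        using mn(1) by (intro exI[of _ "n - m"]) auto
    qed
    \<comment> \<open>Rank at most one excludes the first alternative, finite generation the
      second.\<close>
    moreover have "\<not> (2 :: enat) \<le> 1"
      by (simp add: one_enat_def numeral_eq_enat)
    ultimately show False
      using assms order_trans by blast
  qed
  with a show thesis
    by (rule that)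
qed

end

lemma near_conj:
  assumes "bij \<phi>" "near \<phi> id" "bij k"
  shows "near (inv_into UNIV \<phi> \<circ> k \<circ> \<phi>) k"
proof -
  have "near (inv_into UNIV \<phi>) id"
    using near_inv[OF assms(2,1) bij_id] by simp
  then have "near (inv_into UNIV \<phi> \<circ> k \<circ> \<phi>) (id \<circ> k \<circ> id)"
    using assms by (intro near_comp) (auto simp: bij_is_inj)
  then show ?thesis
    by simp
qed

section \<open>Groups of permutations embedding modulo finite sets\<close>

text \<open>The abstract form of a realization: \<open>near_imp_eq\<close> expresses injectivity of
  the projection on \<open>H\<close>. Without reference to \<open>PC_hat\<close> the notion passes
  directly to conjugates by finitely supported permutations.\<close>

locale lifted_group =
  fixes H :: "('a \<Rightarrow> 'a) set"
  assumes id_mem: "id \<in> H"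
    and bij_mem: "g \<in> H \<Longrightarrow> bij g"
    and comp_mem: "g \<in> H \<Longrightarrow> h \<in> H \<Longrightarrow> g \<circ> h \<in> H"
    and inv_mem: "g \<in> H \<Longrightarrow> inv_into UNIV g \<in> H"
    and near_imp_eq: "g \<in> H \<Longrightarrow> h \<in> H \<Longrightarrow> near g h \<Longrightarrow> g = h"
begin

lemma inj_mem: "g \<in> H \<Longrightarrow> g x = g y \<longleftrightarrow> x = y"
  using bij_mem by (auto dest: bij_is_inj injD)

lemma inv_mem_apply [simp]:
  assumes "g \<in> H"
  shows "inv_into UNIV g (g x) = x" "g (inv_into UNIV g x) = x"
  using bij_mem[OF assms] by (simp_all add: bij_is_inj bij_is_surj surj_f_inv_f)

text \<open>Off the finite set \<open>D\<close> and its preimages the usual argument for disjoint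
  supports gives commutation, and \<open>near_imp_eq\<close> extends the identity to every point. An
  exact conclusion thus comes from supports known only up to finite sets.\<close>

lemma commute_if_disjoint:
  assumes g: "g \<in> H" and c: "c \<in> H"
    and "finite ({x. c x \<noteq> x} - V)" and "finite ({x. g x \<noteq> x} \<inter> V)"
  shows "g (c x) = c (g x)"
proof -
  define D where "D = ({x. c x \<noteq> x} - V) \<union> ({x. g x \<noteq> x} \<inter> V)"
  have D: "finite D"
    using assms by (simp add: D_def)
  have "{x. (g \<circ> c) x \<noteq> (c \<circ> g) x} \<subseteq> D \<union> c -` D \<union> g -` D"
  proof (rule ccontr)
    assume "\<not> ?thesis"
    then obtain x where x: "g (c x) \<noteq> c (g x)" "x \<notin> D" "c x \<notin> D" "g x \<notin> D"
      by auto
    show False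
    proof (cases "c x = x")
      case True
      then have "c (g x) \<noteq> g x" "g x \<noteq> x"
        using x by auto
      then show False
        using x(4) inj_mem[OF g, of "g x" x] by (auto simp: D_def)
    next
      case False
      \<comment> \<open>A point moved by \<open>c\<close> has a moved image, so \<open>x\<close> and
        \<open>c x\<close> both lie in \<open>V\<close>, where \<open>g\<close> is trivial off
        \<open>D\<close>.\<close>
      then have "c (c x) \<noteq> c x"
        using inj_mem[OF c] by simp
      then have "x \<in> V" "c x \<in> V"
        using x False by (auto simp: D_def)
      then have "g x = x" "g (c x) = c x"
        using x by (auto simp: D_def)
      then show False
        using x(1) by simp
    qed
  qed
  moreover have "finite (D \<union> c -` D \<union> g -` D)"
    using D bij_mem[OF g] bij_mem[OF c] by (auto intro!: finite_vimageI simp: bij_is_inj)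
  ultimately have "near (g \<circ> c) (c \<circ> g)"
    unfolding near_def by (rule finite_subset)
  then have "g \<circ> c = c \<circ> g"
    using near_imp_eq comp_mem g c by blast
  then show ?thesis
    by (simp add: fun_eq_iff)
qed

text \<open>A finitely supported \<phi> changes each element at finitely many points only, so
  distinct elements stay distinct modulo finite sets.\<close>

lemma lifted_group_conj:
  assumes \<phi>: "bij \<phi>" "near \<phi> id"
  shows "lifted_group ((\<lambda>h. inv_into UNIV \<phi> \<circ> h \<circ> \<phi>) ` H)"
proof
  let ?K = "\<lambda>h. inv_into UNIV \<phi> \<circ> h \<circ> \<phi>"
  have inv_\<phi>: "inv_into UNIV \<phi> (\<phi> x) = x" "\<phi> (inv_into UNIV \<phi> x) = x" for x
    using \<phi>(1) by (simp_all add: bij_is_inj bij_is_surj surj_f_inv_f)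
  show "id \<in> ?K ` H"
    by (rule image_eqI[OF _ id_mem]) (simp add: fun_eq_iff inv_\<phi>)
  have bij: "bij (?K h)" if "h \<in> H" for h
    using \<phi>(1) bij_mem[OF that] by (intro bij_comp bij_imp_bij_inv)
  show "bij g" if "g \<in> ?K ` H" for g
    using that bij by auto
  show "g \<circ> h \<in> ?K ` H" if "g \<in> ?K ` H" "h \<in> ?K ` H" for g h
  proof -
    from that obtain g' h' where "g' \<in> H" "h' \<in> H" "g = ?K g'" "h = ?K h'"
      by blast
    then show ?thesis
      by (intro image_eqI[of _ _ "g' \<circ> h'"] comp_mem) (auto simp: fun_eq_iff inv_\<phi>)
  qed
  show "inv_into UNIV g \<in> ?K ` H" if "g \<in> ?K ` H" for g
  proof -
    from that obtain g' where g': "g' \<in> H" "g = ?K g'"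
      by blast
    have "inv_into UNIV g = ?K (inv_into UNIV g')"
      using g' by (intro inv_unique_comp) (auto simp: fun_eq_iff inv_\<phi>)
    then show ?thesis
      using inv_mem[OF g'(1)] by blast
  qed
  show "g = h" if "g \<in> ?K ` H" "h \<in> ?K ` H" "near g h" for g h
  proof -
    from that(1,2) obtain g' h' where gh: "g' \<in> H" "h' \<in> H" "g = ?K g'" "h = ?K h'"
      by blast
    have "near (?K k) k" if "k \<in> H" for k
      using near_conj[OF \<phi> bij_mem[OF that]] .
    then have "near g' h'"
      using gh that(3) near_trans near_sym by metis
    then show ?thesis
      using gh near_imp_eq by blast
  qed
qed

end

text \<open>The finite set of moved points is mapped injectively into itself, hence onto
  itself.\<close>

lemma bij_if_inj_near_id:
  assumes "inj \<phi>" "near \<phi> id"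
  shows "bij \<phi>"
proof -
  let ?M = "{x. \<phi> x \<noteq> x}"
  have "\<phi> ` ?M \<subseteq> ?M"
    using assms(1) by (auto dest: injD)
  moreover have "finite ?M"
    using assms(2) by (simp add: near_def)
  ultimately have "\<phi> ` ?M = ?M"
    using assms(1) by (meson endo_inj_surj inj_on_subset subset_UNIV)
  have "y \<in> range \<phi>" for y
  proof (cases "y \<in> ?M")
    case True
    then show ?thesis
      using \<open>\<phi> ` ?M = ?M\<close> by blast
  next
    case False
    then have "y = \<phi> y"
      by simp
    then show ?thesis
      by (rule range_eqI)
  qed
  then show ?thesis
    using assms(1) by (auto simp: bij_def)
qed

section \<open>Straightening the rotations\<close>

lemma eventually_notin_finite_int:
  fixes S :: "int set"
  assumes "finite S"
  shows "eventually (\<lambda>n. n \<notin> S) at_top" "eventually (\<lambda>n. n \<notin> S) at_bot"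
proof -
  have "eventually (\<lambda>n. n > Max (insert 0 S)) at_top" "eventually (\<lambda>n. n \<le> Min (insert 0 S) - 1) at_bot"
    by (rule eventually_gt_at_top eventually_le_at_bot)+
  then show "eventually (\<lambda>n. n \<notin> S) at_top" "eventually (\<lambda>n. n \<notin> S) at_bot"
    using assms by (auto elim!: eventually_mono)
qed

text \<open>The conjugating map is the limit, as \<open>n\<close> tends to either infinity, of undoing the lifted
  \<open>n\<close>-th power of an irrational rotation after the genuine one. Both limits commute with \<open>L\<close>, and
  they can only differ on finitely many orbits of that rotation, so they agree; agreement at both
  ends makes the support finite.\<close>

lemma straighten_rotations:
  fixes H :: "(circle \<Rightarrow> circle) set" and L :: "circle set"
  assumes "lifted_group H"
    and L_add: "\<And>s t. s \<in> L \<Longrightarrow> t \<in> L \<Longrightarrow> s + t \<in> L"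
    and L_minus: "\<And>t. t \<in> L \<Longrightarrow> - t \<in> L"
    and L_lift: "\<And>t. t \<in> L \<Longrightarrow> \<exists>h\<in>H. near h (rotation t)"
    and \<theta>: "to_circle \<theta> \<in> L"
    and \<theta>_inf: "\<And>n::nat. n > 0 \<Longrightarrow> to_circle (of_nat n * \<theta>) \<noteq> 0"
    and L_inf: "\<And>Y. finite Y \<Longrightarrow> \<exists>t\<in>L. \<forall>y\<in>Y. \<forall>k::int. t \<noteq> y + to_circle (of_int k * \<theta>)"
  shows "\<exists>\<phi>. bij \<phi> \<and> near \<phi> id \<and> (\<forall>t\<in>L. \<exists>h\<in>H. h \<circ> \<phi> = \<phi> \<circ> rotation t)"
proof -
  interpret lifted_group H by fact
  obtain \<rho> where \<rho>: "\<And>t. t \<in> L \<Longrightarrow> \<rho> t \<in> H" "\<And>t. t \<in> L \<Longrightarrow> near (\<rho> t) (rotation t)"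
    using L_lift by metis
  have inj_rotation: "inj (rotation t)" for t
    by (auto simp: rotation_def inj_def)
  have \<rho>_add: "\<rho> (s + t) = \<rho> s \<circ> \<rho> t" if "s \<in> L" "t \<in> L" for s t
  proof (rule near_imp_eq)
    have "near (\<rho> s \<circ> \<rho> t) (rotation s \<circ> rotation t)"
      using that \<rho> bij_mem by (intro near_comp) (auto simp: bij_is_inj)
    then show "near (\<rho> (s + t)) (\<rho> s \<circ> \<rho> t)"
      using \<rho>(2)[OF L_add[OF that]] unfolding rotation_add by (metis near_sym near_trans)
  qed (use that \<rho> L_add comp_mem in auto)
  have L_0: "0 \<in> L"
    using L_add[OF \<theta> L_minus[OF \<theta>]] by simp
  have \<rho>_0: "\<rho> 0 = id"
    using near_imp_eq[OF \<rho>(1)[OF L_0] id_mem] \<rho>(2)[OF L_0] by (simp add: rotation_0)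
  define m where "m n = to_circle (of_int n * \<theta>)" for n :: int
  have m_add: "m (n + k) = m n + m k" for n k
    by (simp add: m_def distrib_right to_circle_add)
  have m_0 [simp]: "m 0 = 0"
    by (simp add: m_def)
  have m_minus: "m (- n) = - m n" for n
    by (simp add: m_def to_circle_minus)
  have m_L: "m n \<in> L" for n
  proof -
    have nat: "m (int k) \<in> L" for k
      by (induction k) (use \<theta> L_add[of "m 1"] in \<open>auto simp: L_0 m_add m_def[of 1]\<close>)
    show ?thesis
      by (cases n rule: int_cases2) (auto simp: nat m_minus L_minus)
  qed
  have m_pos: "m n \<noteq> 0" if "n > 0" for n
    using \<theta>_inf[of "nat n"] that by (simp add: m_def)
  have m_inj: "inj m"
  proof (rule injI)
    fix n k assume "m n = m k"
    then have "m (n - k) = 0" "m (k - n) = 0"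
      using m_add[of n "- k"] m_add[of k "- n"] by (simp_all add: m_minus)
    then show "n = k"
      using m_pos[of "n - k"] m_pos[of "k - n"] by linarith
  qed
  have fin_m: "finite {n. x + m n \<in> A}" if "finite A" for x A
  proof -
    have "finite ((\<lambda>n. x + m n) -` A)"
      using that m_inj by (intro finite_vimageI) (auto simp: inj_def)
    then show ?thesis by (simp add: vimage_def)
  qed
  define \<psi> where "\<psi> n x = \<rho> (m (- n)) (x + m n)" for n x
  \<comment> \<open>The defect of the lifted generator. By \<open>\<psi>_step\<close> the sequence
    at \<open>x\<close> changes only at indices \<open>n\<close> with \<open>x + m n\<close> in
    \<open>B\<close>; as \<open>m\<close> is injective, there are finitely many of them.\<close>
  define B where "B = {x. \<rho> (m 1) x \<noteq> x + m 1}"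
  have B: "finite B"
    using \<rho>(2)[OF m_L[of 1]] by (simp add: B_def near_def rotation_def)
  have \<psi>_step: "\<psi> (n + 1) x = \<psi> n x" if "x + m n \<notin> B" for n x
  proof -
    have "m (- n) = m (- (n + 1)) + m 1"
      by (simp flip: m_add)
    then have "\<psi> n x = \<rho> (m (- (n + 1))) (\<rho> (m 1) (x + m n))"
      by (simp add: \<psi>_def \<rho>_add m_L)
    also have "\<dots> = \<psi> (n + 1) x"
      using that by (simp add: B_def \<psi>_def m_add add_ac)
    finally show ?thesis ..
  qed
  have up: "\<psi> n x = \<psi> k x" if "\<forall>j\<ge>k. x + m j \<notin> B" "n \<ge> k" for n k x
    using that(2) by (induction rule: int_ge_induct) (use that(1) \<psi>_step in auto)
  \<comment> \<open>Strict here and weak in \<open>up\<close>: passing from index \<open>j\<close>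
    to \<open>j + 1\<close> tests \<open>x + m j\<close>, so descending from \<open>k\<close> tests
    only indices below \<open>k\<close>.\<close>
  have down: "\<psi> n x = \<psi> k x" if "\<forall>j<k. x + m j \<notin> B" "n \<le> k" for n k x
    using that(2)
  proof (induction rule: int_le_induct)
    case (step i)
    then show ?case
      using \<psi>_step[of x "i - 1"] that(1) by simp
  qed simp
  have ev_up: "\<exists>y. eventually (\<lambda>n. \<psi> n x = y) at_top" for x
  proof -
    have "eventually (\<lambda>n. x + m n \<notin> B) at_top"
      using eventually_notin_finite_int(1)[OF fin_m[OF B]] by simp
    then obtain k where "\<forall>j\<ge>k. x + m j \<notin> B"
      by (auto simp: eventually_at_top_linorder)
    then show ?thesis
      using up unfolding eventually_at_top_linorder by blast
  qed
  have ev_down: "\<exists>y. eventually (\<lambda>n. \<psi> n x = y) at_bot" for x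
  proof -
    have "eventually (\<lambda>n. x + m n \<notin> B) at_bot"
      using eventually_notin_finite_int(2)[OF fin_m[OF B]] by simp
    then obtain k where "\<forall>j\<le>k. x + m j \<notin> B"
      by (auto simp: eventually_at_bot_linorder)
    then have "\<forall>j<k. x + m j \<notin> B"
      by simp
    then show ?thesis
      using down unfolding eventually_at_bot_linorder by blast
  qed
  obtain P where P: "\<And>x. eventually (\<lambda>n. \<psi> n x = P x) at_top"
    using ev_up by metis
  obtain M where M: "\<And>x. eventually (\<lambda>n. \<psi> n x = M x) at_bot"
    using ev_down by metis
  have P_eq: "P x = \<psi> k x" if "\<forall>j\<ge>k. x + m j \<notin> B" for k x
  proof -
    have "eventually (\<lambda>n. \<psi> n x = P x \<and> k \<le> n) at_top"
      using P[of x] eventually_ge_at_top[of k] by (rule eventually_conj)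
    from eventually_happens'[OF trivial_limit_at_top_linorder this]
    obtain n where "\<psi> n x = P x" and kn: "k \<le> n"
      by auto
    then show ?thesis
      using up[OF that kn] by simp
  qed
  have M_eq: "M x = \<psi> k x" if "\<forall>j<k. x + m j \<notin> B" for k x
  proof -
    have "eventually (\<lambda>n. \<psi> n x = M x \<and> n \<le> k) at_bot"
      using M[of x] eventually_le_at_bot[of k] by (rule eventually_conj)
    from eventually_happens'[OF trivial_limit_at_bot_linorder this]
    obtain n where "\<psi> n x = M x" and kn: "n \<le> k"
      by auto
    then show ?thesis
      using down[OF that kn] by simp
  qed
  have equi: "\<rho> t (Q x) = Q (x + t)"
    if t: "t \<in> L" and Q: "\<And>x. eventually (\<lambda>n. \<psi> n x = Q x) F"
      and F: "F \<noteq> bot" "\<And>S. finite S \<Longrightarrow> eventually (\<lambda>n. n \<notin> S) F" for t Q F x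
  proof -
    have "finite {x. \<rho> t x \<noteq> x + t}"
      using \<rho>(2)[OF t] by (simp add: near_def rotation_def)
    from F(2)[OF fin_m[OF this, of x]] have "eventually (\<lambda>n. \<rho> t (x + m n) = x + m n + t) F"
      by simp
    then have "eventually (\<lambda>n. \<rho> t (Q x) = Q (x + t)) F"
      using Q[of x] Q[of "x + t"]
    proof eventually_elim
      case (elim n)
      have "\<rho> t (\<psi> n x) = (\<rho> t \<circ> \<rho> (m (- n))) (x + m n)"
        by (simp add: \<psi>_def)
      \<comment> \<open>\<open>L\<close> is commutative, so \<open>\<rho> t\<close> passes through
        the lifted power; only its action on \<open>x + m n\<close> must be genuine, which holds for
        all but finitely many \<open>n\<close>.\<close>
      also have "\<rho> t \<circ> \<rho> (m (- n)) = \<rho> (m (- n)) \<circ> \<rho> t"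
        using t m_L by (simp add: add.commute flip: \<rho>_add)
      also have "(\<rho> (m (- n)) \<circ> \<rho> t) (x + m n) = \<psi> n (x + t)"
        using elim by (simp add: \<psi>_def add_ac)
      finally show ?case
        using elim by simp
    qed
    then show ?thesis
      using F(1) by simp
  qed
  have P_equi: "\<rho> t (P x) = P (x + t)" if "t \<in> L" for t x
    by (rule equi[OF that P]) (auto intro: eventually_notin_finite_int)
  have M_equi: "\<rho> t (M x) = M (x + t)" if "t \<in> L" for t x
    by (rule equi[OF that M]) (auto intro: eventually_notin_finite_int)
  have PM: "P x = M x" for x
  proof (rule ccontr)
    assume neq: "P x \<noteq> M x"
    \<comment> \<open>Infinite index provides a \<open>t\<close> for which the whole orbit of
      \<open>x + t\<close> avoids \<open>B\<close>. There both limits equal \<open>\<psi> 0\<close>,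
      and equivariance carries the equality back to \<open>x\<close>.\<close>
    obtain t where t: "t \<in> L" "\<forall>y\<in>(\<lambda>b. b - x) ` B. \<forall>k. t \<noteq> y + m k"
      using L_inf[of "(\<lambda>b. b - x) ` B"] B by (auto simp: m_def)
    have "x + t + m n \<notin> B" for n
    proof
      assume "x + t + m n \<in> B"
      then have "t \<noteq> (x + t + m n - x) + m (- n)"
        using t(2) by blast
      then show False
        by (simp add: m_minus)
    qed
    then have "P (x + t) = M (x + t)"
      using P_eq[of 0 "x + t"] M_eq[of 0 "x + t"] by simp
    then have "\<rho> t (P x) = \<rho> t (M x)"
      using t(1) by (simp add: P_equi M_equi)
    then show False
      using neq inj_mem[OF \<rho>(1)[OF t(1)]] by simp
  qed
  have \<psi>_0: "\<psi> 0 x = x" for x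
    by (simp add: \<psi>_def \<rho>_0)
  \<comment> \<open>Times between two visits to \<open>B\<close>. A point moved by both limits
    visits \<open>B\<close> at some \<open>n \<ge> 0\<close> and some \<open>k < 0\<close>; then
    \<open>n\<close> is less than \<open>n - k\<close>, hence bounded by \<open>Max K\<close>, and
    \<open>x\<close> is recovered from the visited point and \<open>n\<close>.\<close>
  define K where "K = {k. 0 + m k \<in> (\<lambda>(b, b'). b - b') ` (B \<times> B)}"
  have K: "finite K"
    unfolding K_def by (rule fin_m) (use B in blast)
  have "{x. P x \<noteq> id x} \<subseteq> (\<lambda>(b, n). b - m n) ` (B \<times> {0..Max K})"
  proof
    fix x assume "x \<in> {x. P x \<noteq> id x}"
    then have "P x \<noteq> \<psi> 0 x" "M x \<noteq> \<psi> 0 x"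
      using PM[of x] by (simp_all add: \<psi>_0)
    then obtain n k where n: "n \<ge> 0" "x + m n \<in> B" and k: "k < 0" "x + m k \<in> B"
      using P_eq[of 0 x] M_eq[of 0 x] by blast
    have "m (n - k) = (x + m n) - (x + m k)"
      using m_add[of n "- k"] by (simp add: m_minus)
    then have "n - k \<in> K"
      using n(2) k(2) by (auto simp: K_def intro!: image_eqI[of _ _ "(x + m n, x + m k)"])
    then have "n - k \<le> Max K"
      using K by simp
    then have "n \<in> {0..Max K}"
      using n(1) k(1) by simp
    then show "x \<in> (\<lambda>(b, n). b - m n) ` (B \<times> {0..Max K})"
      using n(2) by (intro image_eqI[of _ _ "(x + m n, n)"]) auto
  qed
  moreover have "finite ((\<lambda>(b, n). b - m n) ` (B \<times> {0..Max K}))"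
    using B by simp
  ultimately have near: "near P id"
    unfolding near_def by (rule finite_subset)
  have "inj P"
  proof (rule injI)
    fix x y assume PP: "P x = P y"
    have "eventually (\<lambda>n. \<psi> n x = P x \<and> \<psi> n y = P y) at_top"
      using P[of x] P[of y] by (rule eventually_conj)
    then obtain n where "\<psi> n x = P x" "\<psi> n y = P y"
      using eventually_happens'[OF trivial_limit_at_top_linorder] by blast
    then have "\<psi> n x = \<psi> n y"
      using PP by simp
    then show "x = y"
      by (simp add: \<psi>_def inj_mem[OF \<rho>(1)[OF m_L]])
  qed
  then have "bij P"
    using near by (rule bij_if_inj_near_id)
  moreover have "\<exists>h\<in>H. h \<circ> P = P \<circ> rotation t" if "t \<in> L" for t
    by (rule bexI[OF _ \<rho>(1)[OF that]]) (simp add: fun_eq_iff rotation_def P_equi[OF that])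
  ultimately show ?thesis
    using near by blast
qed

section \<open>Switches\<close>

lemma infinite_if_meets_intervals:
  fixes S :: "real set"
  assumes "u < v" and dense: "\<And>u v. u < v \<Longrightarrow> \<exists>t\<in>S. u < t \<and> t < v"
  shows "infinite (S \<inter> {u<..<v})"
proof
  assume fin: "finite (S \<inter> {u<..<v})"
  define w where "w = Min (insert v (S \<inter> {u<..<v}))"
  have "u < w" "w \<le> v"
    using fin \<open>u < v\<close> by (auto simp: w_def)
  then obtain t where t: "t \<in> S" "u < t" "t < w"
    using dense by blast
  then have "w \<le> t"
    using fin \<open>w \<le> v\<close> by (auto simp: w_def intro!: Min_le)
  with t show False by simp
qed

lemma partial_rotation_to_circle:
  assumes "0 < s" "s < l" "l < 1"
  shows "a \<le> t \<Longrightarrow> t < a + l - s \<Longrightarrow> partial_rotation a l s (to_circle t) = to_circle (t + s)"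
    and "a + l - s \<le> t \<Longrightarrow> t < a + l \<Longrightarrow> partial_rotation a l s (to_circle t) = to_circle (t + s - l)"
    and "a + l \<le> t \<Longrightarrow> t < a + 1 \<Longrightarrow> partial_rotation a l s (to_circle t) = to_circle t"
proof -
  have off: "circle_offset a (to_circle t) = t - a" if "a \<le> t" "t < a + 1" for t
    using that by (simp add: circle_offset_to_circle frac_eq)
  show "partial_rotation a l s (to_circle t) = to_circle (t + s)" if "a \<le> t" "t < a + l - s"
    using that assms by (simp add: partial_rotation_def off)
  show "partial_rotation a l s (to_circle t) = to_circle (t + s - l)" if "a + l - s \<le> t" "t < a + l"
  proof -
    have "(t - a + s) rmod l = t - a + s - l"
      by (rule rmod_unique[of _ l _ 1]) (use that assms in auto)
    then have "a + (t - a + s) rmod l = t + s - l"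
      by simp
    then show ?thesis
      using that assms by (simp add: partial_rotation_def off)
  qed
  show "partial_rotation a l s (to_circle t) = to_circle t" if "a + l \<le> t" "t < a + 1"
    using that assms by (simp add: partial_rotation_def off)
qed

text \<open>The situation after straightening: a dense set of rotations belongs to \<open>H\<close>
  exactly, whereas partial rotations are available up to finite sets.\<close>

locale dense_rotations = lifted_group H for H :: "(circle \<Rightarrow> circle) set" +
  fixes a l :: real
  assumes l: "0 < l" "l < 1"
    and rotation_dense: "\<And>u v. u < v \<Longrightarrow> \<exists>t. rotation (to_circle t) \<in> H \<and> u < t \<and> t < v"
    and partial_rotation_dense:
      "\<And>u v. u < v \<Longrightarrow> \<exists>s. (\<exists>p\<in>H. near p (partial_rotation a l s)) \<and> u < s \<and> s < v"
begin

definition lengths :: "real set" where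
  "lengths = {s. 0 < s \<and> s < l \<and> (\<exists>p\<in>H. near p (partial_rotation a l s))}"

lemma infinite_lengths:
  assumes "u < v" "0 \<le> u" "v \<le> l"
  shows "infinite (lengths \<inter> {u<..<v})"
proof -
  have "infinite ({s. \<exists>p\<in>H. near p (partial_rotation a l s)} \<inter> {u<..<v})"
    by (rule infinite_if_meets_intervals[OF \<open>u < v\<close>]) (use partial_rotation_dense in blast)
  moreover have "{s. \<exists>p\<in>H. near p (partial_rotation a l s)} \<inter> {u<..<v} \<subseteq> lengths \<inter> {u<..<v}"
    using assms by (auto simp: lengths_def)
  ultimately show ?thesis
    using finite_subset by blast
qed

text \<open>The commutator of a partial rotation with a small rotation permutes three short intervals
  cyclically. Only the action on the middle interval is needed.\<close>

lemma base_switch: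
  assumes s: "s \<in> lengths" and \<delta>: "rotation (to_circle \<delta>) \<in> H" "0 < \<delta>"
    "\<delta> < s" "\<delta> < l - s" "\<delta> < 1 - l"
  obtains c F where "c \<in> H" "finite F"
    "\<And>t. a + l - s - \<delta> \<le> t \<Longrightarrow> t < a + l - s \<Longrightarrow> to_circle t \<notin> F \<Longrightarrow> c (to_circle t) = to_circle (t + s)"
    "\<And>x. x \<notin> F \<Longrightarrow> c x \<noteq> x \<Longrightarrow>
       x \<in> to_circle ` ({a - \<delta>..<a} \<union> {a + l - s - \<delta>..<a + l - s} \<union> {a + l - \<delta>..<a + l})"
proof -
  obtain p where p: "p \<in> H" "near p (partial_rotation a l s)" and s': "0 < s" "s < l"
    using s by (auto simp: lengths_def)
  define q where "q = partial_rotation a l s"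
  define r where "r = rotation (to_circle \<delta>)"
  note q = partial_rotation_to_circle[OF s' l(2), of a, folded q_def]
  define E where "E = {x. p x \<noteq> q x}"
  \<comment> \<open>The points at which the computation of \<open>c\<close> could meet a value of
    \<open>p\<close> that differs from \<open>q\<close>: besides \<open>x\<close> itself it
    evaluates \<open>p\<close> at \<open>x + \<delta>\<close> for the support and at
    \<open>x + s + \<delta>\<close> for the middle interval.\<close>
  define F where "F = E \<union> (\<lambda>x. x + to_circle \<delta>) -` E \<union> (\<lambda>x. x + to_circle (s + \<delta>)) -` E"
  have F: "finite F"
  proof -
    have "finite E"
      using p(2) by (simp add: E_def near_def q_def)
    then show ?thesis
      unfolding F_def by (intro finite_UnI finite_vimageI injI) simp_all
  qed
  define c where "c = inv_into UNIV r \<circ> inv_into UNIV p \<circ> (r \<circ> p)"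
  have r: "r \<in> H" "r x = x + to_circle \<delta>" for x
    using \<delta>(1) by (simp_all add: r_def rotation_def)
  have "c \<in> H"
    unfolding c_def using r(1) p(1) by (intro comp_mem inv_mem)
  have c_eq: "c x = y" if "p (y + to_circle \<delta>) = p x + to_circle \<delta>" for x y
  proof -
    have "r (p x) = p (r y)"
      using that by (simp add: r)
    then show ?thesis
      using r(1) p(1) by (simp add: c_def)
  qed
  have act: "c (to_circle t) = to_circle (t + s)"
    if t: "a + l - s - \<delta> \<le> t" "t < a + l - s" "to_circle t \<notin> F" for t
  proof (rule c_eq)
    have "p (to_circle t) = to_circle (t + s)"
      using q(1)[of t] t \<delta> by (simp add: F_def E_def)
    moreover have "to_circle (t + s) + to_circle \<delta> = to_circle (t + s + \<delta>)"
      by (simp add: to_circle_add)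
    moreover have "to_circle t + to_circle (s + \<delta>) \<notin> E"
      using t(3) by (auto simp: F_def)
    then have "to_circle (t + s + \<delta>) \<notin> E"
      by (simp add: to_circle_add add_ac)
    \<comment> \<open>\<open>t + s + \<delta>\<close> has been pushed to or past the right end
      \<open>a + l\<close>, by less than the length \<open>1 - l\<close> of the complement, so the
      partial rotation fixes it.\<close>
    then have "p (to_circle (t + s + \<delta>)) = to_circle (t + s + \<delta>)"
      using q(3)[of "t + s + \<delta>"] t \<delta> by (simp add: E_def)
    ultimately show "p (to_circle (t + s) + to_circle \<delta>) = p (to_circle t) + to_circle \<delta>"
      by simp
  qed
  have supp: "x \<in> to_circle ` ({a - \<delta>..<a} \<union> {a + l - s - \<delta>..<a + l - s} \<union> {a + l - \<delta>..<a + l})"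
    if x: "x \<notin> F" "c x \<noteq> x" for x
  proof (rule ccontr)
    assume notin: "\<not> ?thesis"
    \<comment> \<open>This fundamental domain starts with the first excluded interval. On each of
      the three remaining ones \<open>t\<close> and \<open>t + \<delta>\<close> lie in the same
      piece of the interval exchange, so that \<open>q\<close> commutes with the rotation
      there.\<close>
    obtain t where t: "x = to_circle t" "a - \<delta> \<le> t" "t < a - \<delta> + 1"
      by (rule to_circle_cases_Ico)
    have "t \<notin> {a - \<delta>..<a} \<union> {a + l - s - \<delta>..<a + l - s} \<union> {a + l - \<delta>..<a + l}"
      using notin t(1) by blast
    then consider "a \<le> t" "t < a + l - s - \<delta>" | "a + l - s \<le> t" "t < a + l - \<delta>" | "a + l \<le> t"
      using t(2) by force
    then have "q (to_circle (t + \<delta>)) = q (to_circle t) + to_circle \<delta>"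
    proof cases
      case 1
      then show ?thesis
        using q(1)[of t] q(1)[of "t + \<delta>"] \<delta> by (simp add: to_circle_add add_ac)
    next
      case 2
      then show ?thesis
        using q(2)[of t] q(2)[of "t + \<delta>"] \<delta> by (simp add: to_circle_add to_circle_diff)
    next
      case 3
      then show ?thesis
        using q(3)[of t] q(3)[of "t + \<delta>"] \<delta> t(3) by (simp add: to_circle_add)
    qed
    moreover have "p x = q x" "p (x + to_circle \<delta>) = q (x + to_circle \<delta>)"
      using x(1) by (auto simp: F_def E_def)
    ultimately have "p (x + to_circle \<delta>) = p x + to_circle \<delta>"
      by (simp add: t(1) to_circle_add)
    then show False
      using c_eq x(2) by blast
  qed
  show thesis
    by (rule that[OF \<open>c \<in> H\<close> F act supp])
qed

text \<open>Conjugating \<open>base_switch\<close> by a genuine rotation by \<mu> moves it to any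
  place. Infinitely many \<mu> bring \<xi> into the middle interval, so one of them also avoids the
  exceptional set; this makes the value at the single point \<xi> exact.\<close>

lemma switch:
  assumes s: "s \<in> lengths" and "\<epsilon> > 0"
  obtains c where "c \<in> H" "c (to_circle \<xi>) = to_circle (\<xi> + s)"
    "finite ({x. c x \<noteq> x} - to_circle ` (ball \<xi> \<epsilon> \<union> ball (\<xi> + s) \<epsilon> \<union> ball (\<xi> + s - l) \<epsilon>))"
proof -
  have s': "0 < s" "s < l"
    using s by (auto simp: lengths_def)
  define d where "d = min (min s (l - s)) (min (1 - l) \<epsilon>)"
  have "0 < d"
    using s' l \<open>\<epsilon> > 0\<close> by (auto simp: d_def)
  then obtain \<delta> where \<delta>: "rotation (to_circle \<delta>) \<in> H" "0 < \<delta>" "\<delta> < d"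
    using rotation_dense by blast
  obtain c F where c: "c \<in> H" "finite F"
    and act: "\<And>t. a + l - s - \<delta> \<le> t \<Longrightarrow> t < a + l - s \<Longrightarrow> to_circle t \<notin> F \<Longrightarrow>
      c (to_circle t) = to_circle (t + s)"
    and supp: "\<And>x. x \<notin> F \<Longrightarrow> c x \<noteq> x \<Longrightarrow>
       x \<in> to_circle ` ({a - \<delta>..<a} \<union> {a + l - s - \<delta>..<a + l - s} \<union> {a + l - \<delta>..<a + l})"
    using base_switch[OF s \<delta>(1,2)] \<delta>(3) unfolding d_def by auto
  \<comment> \<open>For \<mu> strictly between \<open>u\<close> and \<open>u + \<delta>\<close> the
    point \<open>\<xi> - \<mu>\<close> lies in the middle interval of the switch.\<close>
  define u where "u = \<xi> - (a + l - s)"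
  define M where "M = {t. rotation (to_circle t) \<in> H} \<inter> {u<..<u + \<delta>}"
  have "infinite M"
    unfolding M_def using \<delta>(2) rotation_dense by (intro infinite_if_meets_intervals) auto
  moreover have "inj_on (\<lambda>\<mu>. to_circle (\<xi> - \<mu>)) M"
  proof (rule inj_onI)
    fix x y assume xy: "x \<in> M" "y \<in> M" "to_circle (\<xi> - x) = to_circle (\<xi> - y)"
    have "\<delta> < 1"
      using \<delta>(3) l by (auto simp: d_def)
    then have "\<xi> - x = \<xi> - y"
      using xy by (intro to_circle_inj_near) (auto simp: M_def)
    then show "x = y" by simp
  qed
  ultimately have "\<not> (\<lambda>\<mu>. to_circle (\<xi> - \<mu>)) ` M \<subseteq> F"
    using c(2) finite_imageD finite_subset by blast
  then obtain \<mu> where "\<mu> \<in> M" "to_circle (\<xi> - \<mu>) \<notin> F"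
    by blast
  then have \<mu>: "rotation (to_circle \<mu>) \<in> H" "u < \<mu>" "\<mu> < u + \<delta>" "to_circle (\<xi> - \<mu>) \<notin> F"
    by (auto simp: M_def)
  define r where "r = rotation (to_circle \<mu>)"
  have r: "r \<in> H" "r x = x + to_circle \<mu>" "inv_into UNIV r x = x - to_circle \<mu>" for x
  proof -
    show "r \<in> H" "r x = x + to_circle \<mu>" for x
      using \<mu>(1) by (simp_all add: r_def rotation_def)
    then show "inv_into UNIV r x = x - to_circle \<mu>"
      by (metis add_diff_cancel inv_mem_apply(1) diff_add_cancel)
  qed
  let ?c = "r \<circ> c \<circ> inv_into UNIV r"
  show thesis
  proof
    show "?c \<in> H"
      using r(1) c(1) by (intro comp_mem inv_mem)
    have "c (to_circle (\<xi> - \<mu>)) = to_circle (\<xi> - \<mu> + s)"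
      using \<mu> by (intro act) (auto simp: u_def)
    then show "?c (to_circle \<xi>) = to_circle (\<xi> + s)"
      by (simp add: r(2,3) flip: to_circle_diff to_circle_add)
    have "{x. ?c x \<noteq> x} - to_circle ` (ball \<xi> \<epsilon> \<union> ball (\<xi> + s) \<epsilon> \<union> ball (\<xi> + s - l) \<epsilon>) \<subseteq> r ` F"
    proof
      fix x assume x: "x \<in> {x. ?c x \<noteq> x} - to_circle ` (ball \<xi> \<epsilon> \<union> ball (\<xi> + s) \<epsilon> \<union> ball (\<xi> + s - l) \<epsilon>)"
      define y where "y = x - to_circle \<mu>"
      have xy: "x = r y"
        by (simp add: r y_def)
      have "c y \<noteq> y"
        using x r(1) by (auto simp: xy)
      have "y \<in> F"
      proof (rule ccontr)
        assume "y \<notin> F"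
        from supp[OF this \<open>c y \<noteq> y\<close>] obtain t where t: "y = to_circle t"
          "t \<in> {a - \<delta>..<a} \<union> {a + l - s - \<delta>..<a + l - s} \<union> {a + l - \<delta>..<a + l}"
          by blast
        have "x = to_circle (t + \<mu>)"
          by (simp add: xy r t(1) to_circle_add)
        moreover have "t + \<mu> \<in> ball \<xi> \<epsilon> \<union> ball (\<xi> + s) \<epsilon> \<union> ball (\<xi> + s - l) \<epsilon>"
          using t(2) \<mu>(2,3) \<delta>(3) unfolding u_def d_def by (auto simp: dist_real_def)
        ultimately show False
          using x by blast
      qed
      then show "x \<in> r ` F"
        by (simp add: xy)
    qed
    then show "finite ({x. ?c x \<noteq> x} - to_circle ` (ball \<xi> \<epsilon> \<union> ball (\<xi> + s) \<epsilon> \<union> ball (\<xi> + s - l) \<epsilon>))"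
      using c(2) finite_subset by blast
  qed
qed

text \<open>A switch at \<open>x\<close> supported in \<open>U\<close> commutes with \<open>g\<close>, so \<open>g\<close> would also move the
  images of \<open>x\<close> under infinitely many switches.\<close>

lemma fixes_if_near_fixed:
  assumes g: "g \<in> H" and U: "open U" "finite ({x. g x \<noteq> x} \<inter> U)"
    and \<xi>: "to_circle \<xi> \<in> U" "to_circle (\<xi> + s0) \<in> U" "to_circle (\<xi> + s0 - l) \<in> U"
    and s0: "0 < s0" "s0 < l"
  shows "g (to_circle \<xi>) = to_circle \<xi>"
proof (rule ccontr)
  assume moved: "g (to_circle \<xi>) \<noteq> to_circle \<xi>"
  have "open (to_circle -` U)"
    using U(1) by (rule open_vimage_to_circle)
  then obtain e1 e2 e3 where e: "e1 > 0" "ball \<xi> e1 \<subseteq> to_circle -` U"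
    "e2 > 0" "ball (\<xi> + s0) e2 \<subseteq> to_circle -` U"
    "e3 > 0" "ball (\<xi> + s0 - l) e3 \<subseteq> to_circle -` U"
    using \<xi> unfolding open_contains_ball by (metis vimage_eq)
  \<comment> \<open>Halved because two errors add up: \<open>s\<close> differs from
    \<open>s0\<close> by less than \<open>e\<close>, and the balls have radius \<open>e\<close>. The
    terms \<open>s0\<close> and \<open>l - s0\<close> keep all these \<open>s\<close> between 0 and
    \<open>l\<close>.\<close>
  define e where "e = min (min (min e1 e2) e3) (min s0 (l - s0)) / 2"
  have e': "e > 0" "2 * e \<le> e1" "2 * e \<le> e2" "2 * e \<le> e3" "2 * e \<le> s0" "2 * e \<le> l - s0"
    using e s0 by (auto simp: e_def)
  have "to_circle (\<xi> + s) \<in> {x. g x \<noteq> x} \<inter> U" if s: "s \<in> lengths \<inter> {s0 - e<..<s0 + e}" for s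
  proof -
    have "ball \<xi> e \<subseteq> ball \<xi> e1" "ball (\<xi> + s) e \<subseteq> ball (\<xi> + s0) e2"
      "ball (\<xi> + s - l) e \<subseteq> ball (\<xi> + s0 - l) e3"
      using s e' by (auto simp: dist_real_def)
    then have sub: "to_circle ` (ball \<xi> e \<union> ball (\<xi> + s) e \<union> ball (\<xi> + s - l) e) \<subseteq> U"
      using e by blast
    obtain c where c: "c \<in> H" "c (to_circle \<xi>) = to_circle (\<xi> + s)"
      "finite ({x. c x \<noteq> x} - to_circle ` (ball \<xi> e \<union> ball (\<xi> + s) e \<union> ball (\<xi> + s - l) e))"
      using switch[of s e \<xi>] s e'(1) by blast
    have "finite ({x. c x \<noteq> x} - U)"
      by (rule finite_subset[OF _ c(3)]) (use sub in blast)
    then have "g (c (to_circle \<xi>)) = c (g (to_circle \<xi>))"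
      using commute_if_disjoint[OF g c(1)] U(2) by blast
    then have "g (to_circle (\<xi> + s)) \<noteq> to_circle (\<xi> + s)"
      using moved inj_mem[OF c(1)] by (metis c(2))
    moreover have "to_circle (\<xi> + s) \<in> U"
      using sub e'(1) by auto
    ultimately show ?thesis by simp
  qed
  then have "(\<lambda>s. to_circle (\<xi> + s)) ` (lengths \<inter> {s0 - e<..<s0 + e}) \<subseteq> {x. g x \<noteq> x} \<inter> U"
    by blast
  then have "finite ((\<lambda>s. to_circle (\<xi> + s)) ` (lengths \<inter> {s0 - e<..<s0 + e}))"
    using U(2) finite_subset by blast
  moreover have "inj_on (\<lambda>s. to_circle (\<xi> + s)) (lengths \<inter> {s0 - e<..<s0 + e})"
  proof (rule inj_onI)
    fix x y assume "x \<in> lengths \<inter> {s0 - e<..<s0 + e}" "y \<in> lengths \<inter> {s0 - e<..<s0 + e}"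
      "to_circle (\<xi> + x) = to_circle (\<xi> + y)"
    then have "\<xi> + x = \<xi> + y"
      using l by (intro to_circle_inj_near) (auto simp: lengths_def)
    then show "x = y" by simp
  qed
  ultimately have "finite (lengths \<inter> {s0 - e<..<s0 + e})"
    by (rule finite_imageD)
  then show False
    using infinite_lengths[of "s0 - e" "s0 + e"] e' s0 by simp
qed

end

section \<open>Cluster values\<close>

text \<open>Counting by infinite sets makes the notion insensitive to changes of \<open>f\<close> on
  finite sets. Unlike a limit, it is symmetric under an involution.\<close>

definition cluster :: "('a :: topological_space \<Rightarrow> 'b :: topological_space) \<Rightarrow> 'a \<Rightarrow> 'b \<Rightarrow> bool" where
  "cluster f y z \<longleftrightarrow> (\<forall>W V. open W \<and> y \<in> W \<and> open V \<and> z \<in> V \<longrightarrow> infinite (W \<inter> f -` V))"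

text \<open>An involution maps the points of \<open>V\<close> with image in \<open>W\<close>
  bijectively to the points of \<open>W\<close> with image in \<open>V\<close>.\<close>

lemma cluster_involution:
  assumes "\<And>x. f (f x) = x" "cluster f y z"
  shows "cluster f z y"
  unfolding cluster_def
proof (intro allI impI)
  fix W V assume WV: "open W \<and> z \<in> W \<and> open V \<and> y \<in> V"
  have "W \<inter> f -` V = f ` (V \<inter> f -` W)"
  proof (intro equalityI subsetI)
    fix x assume "x \<in> W \<inter> f -` V"
    then have "f x \<in> V \<inter> f -` W" "x = f (f x)"
      using assms(1) by auto
    then show "x \<in> f ` (V \<inter> f -` W)"
      by blast
  qed (use assms(1) in auto)
  moreover have "infinite (V \<inter> f -` W)"
    using assms(2) WV unfolding cluster_def by blast
  moreover have "inj f"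
    using assms(1) by (metis injI)
  ultimately show "infinite (W \<inter> f -` V)"
    using finite_imageD inj_on_subset by (metis subset_UNIV)
qed

context dense_rotations
begin

text \<open>Otherwise the conjugate by \<open>f\<close> of a suitable switch at \<open>x\<close> would be the identity near
  \<open>f x\<close> up to finite sets, yet move \<open>f x\<close>.\<close>

lemma involution_cluster:
  assumes f: "f \<in> H" "\<And>x. f (f x) = x" and fin: "\<And>y. finite {z. cluster f y z}"
  shows "cluster f x (f x)"
proof (rule ccontr)
  assume x: "\<not> ?thesis"
  obtain \<xi> where \<xi>: "x = to_circle \<xi>"
    by (rule to_circle_cases)
  obtain \<zeta> where \<zeta>: "f x = to_circle \<zeta>"
    by (rule to_circle_cases)
  have finy: "finite {y. cluster f y z}" for z
    by (rule finite_subset[OF _ fin[of z]]) (use cluster_involution[OF f(2)] in blast)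
  have fin_shift: "finite {s. 0 < s \<and> s < l \<and> to_circle (t + s) \<in> A}" if "finite A" for t A
  proof (rule finite_imageD)
    show "finite ((\<lambda>s. to_circle (t + s)) ` {s. 0 < s \<and> s < l \<and> to_circle (t + s) \<in> A})"
      by (rule finite_subset[OF _ that]) blast
    show "inj_on (\<lambda>s. to_circle (t + s)) {s. 0 < s \<and> s < l \<and> to_circle (t + s) \<in> A}"
    proof (rule inj_onI)
      fix u v assume "u \<in> {s. 0 < s \<and> s < l \<and> to_circle (t + s) \<in> A}"
        "v \<in> {s. 0 < s \<and> s < l \<and> to_circle (t + s) \<in> A}" "to_circle (t + u) = to_circle (t + v)"
      then have "t + u = t + v"
        using l by (intro to_circle_inj_near) auto
      then show "u = v" by simp
    qed
  qed
  \<comment> \<open>Each of the two conditions excludes finitely many \<open>s\<close>, so every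
    infinite set of parameters contains an admissible one.\<close>
  have choose: "\<exists>s\<in>S. to_circle (t + s) \<notin> A \<and> to_circle (t + s - l) \<notin> A"
    if S: "infinite S" "S \<subseteq> {0<..<l}" and A: "finite A" for S t A
  proof (rule ccontr)
    assume "\<not> ?thesis"
    then have "S \<subseteq> {s. 0 < s \<and> s < l \<and> to_circle (t + s) \<in> A}
        \<union> {s. 0 < s \<and> s < l \<and> to_circle (t - l + s) \<in> A}"
      using S(2) by (auto simp: algebra_simps)
    then show False
      using S(1) fin_shift[OF A] by (meson finite_UnI finite_subset)
  qed
  have "infinite (lengths \<inter> {0<..<l})"
    using infinite_lengths[of 0 l] l by simp
  \<comment> \<open>The parameter \<open>s\<close> keeps \<open>f x\<close> from being a cluster
    value at the other two places of the switch. Afterwards \<open>s0\<close> is chosen so that the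
    two companions of \<open>f x\<close> are no cluster values at any of its three places.\<close>
  then obtain s where s: "s \<in> lengths" "\<not> cluster f (to_circle (\<xi> + s)) (f x)"
    "\<not> cluster f (to_circle (\<xi> + s - l)) (f x)"
    using choose[OF _ _ finy[of "f x"], of "lengths \<inter> {0<..<l}" \<xi>] by blast
  define Y where "Y = {to_circle \<xi>, to_circle (\<xi> + s), to_circle (\<xi> + s - l)}"
  have "infinite {0<..<l}"
    using l by simp
  moreover have "finite (\<Union>y\<in>Y. {z. cluster f y z})"
    using fin by (auto simp: Y_def)
  ultimately obtain s0 where s0: "0 < s0" "s0 < l"
    "\<forall>y\<in>Y. \<not> cluster f y (to_circle (\<zeta> + s0)) \<and> \<not> cluster f y (to_circle (\<zeta> + s0 - l))"
    using choose[of "{0<..<l}" "\<Union>y\<in>Y. {z. cluster f y z}" \<zeta>] by auto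
  define Z where "Z = {to_circle \<zeta>, to_circle (\<zeta> + s0), to_circle (\<zeta> + s0 - l)}"
  have not_cluster: "\<not> cluster f y z" if "y \<in> Y" "z \<in> Z" for y z
    using that s0(3) s(2,3) x unfolding Y_def Z_def \<zeta>[symmetric] \<xi>[symmetric] by auto
  have "\<exists>W V. open W \<and> y \<in> W \<and> open V \<and> z \<in> V \<and> finite (W \<inter> f -` V)" if "y \<in> Y" "z \<in> Z" for y z
    using not_cluster[OF that] unfolding cluster_def by blast
  then obtain W V where WV: "\<And>y z. y \<in> Y \<Longrightarrow> z \<in> Z \<Longrightarrow> open (W y z) \<and> y \<in> W y z \<and>
      open (V y z) \<and> z \<in> V y z \<and> finite (W y z \<inter> f -` V y z)"
    by metis
  define W' where "W' = (\<Union>y\<in>Y. \<Inter>z\<in>Z. W y z)"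
  define U where "U = (\<Union>z\<in>Z. \<Inter>y\<in>Y. V y z)"
  have YZ: "finite Y" "finite Z"
    by (simp_all add: Y_def Z_def)
  have W': "open W'" "Y \<subseteq> W'"
    unfolding W'_def using WV YZ by (auto intro!: open_UN open_INT)
  have U: "open U" "Z \<subseteq> U"
    unfolding U_def using WV YZ by (auto intro!: open_UN open_INT)
  have "W' \<inter> f -` U \<subseteq> (\<Union>y\<in>Y. \<Union>z\<in>Z. W y z \<inter> f -` V y z)"
    unfolding W'_def U_def by blast
  moreover have "finite (\<Union>y\<in>Y. \<Union>z\<in>Z. W y z \<inter> f -` V y z)"
    using WV YZ by auto
  ultimately have fin_WU: "finite (W' \<inter> f -` U)"
    by (rule finite_subset)
  have "open (to_circle -` W')"
    using W'(1) by (rule open_vimage_to_circle)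
  then obtain e1 e2 e3 where e: "e1 > 0" "ball \<xi> e1 \<subseteq> to_circle -` W'"
    "e2 > 0" "ball (\<xi> + s) e2 \<subseteq> to_circle -` W'"
    "e3 > 0" "ball (\<xi> + s - l) e3 \<subseteq> to_circle -` W'"
    using W'(2) unfolding open_contains_ball Y_def by (metis insert_subset vimage_eq)
  define e where "e = min (min e1 e2) e3"
  have "e > 0"
    using e by (simp add: e_def)
  then obtain c where c: "c \<in> H" "c (to_circle \<xi>) = to_circle (\<xi> + s)"
    "finite ({x. c x \<noteq> x} - to_circle ` (ball \<xi> e \<union> ball (\<xi> + s) e \<union> ball (\<xi> + s - l) e))"
    using switch[OF s(1)] by blast
  have "to_circle ` (ball \<xi> e \<union> ball (\<xi> + s) e \<union> ball (\<xi> + s - l) e) \<subseteq> W'"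
    using e by (auto simp: e_def)
  then have cW: "finite ({x. c x \<noteq> x} - W')"
    using c(3) by (rule_tac finite_subset[OF _ c(3)]) blast
  \<comment> \<open>\<open>c\<close> acts inside \<open>W'\<close> up to finite sets, and
    \<open>f\<close> sends only finitely many points of \<open>W'\<close> into \<open>U\<close>; so
    this conjugate is trivial on \<open>U\<close> modulo finite sets, although it moves
    \<open>f x\<close>.\<close>
  define g where "g = f \<circ> c \<circ> f"
  have "g \<in> H"
    unfolding g_def using f(1) c(1) by (intro comp_mem)
  have "{x. g x \<noteq> x} \<inter> U \<subseteq> f ` (({x. c x \<noteq> x} - W') \<union> (W' \<inter> f -` U))"
  proof
    fix w assume w: "w \<in> {x. g x \<noteq> x} \<inter> U"
    then have "c (f w) \<noteq> f w"
      using f(2) by (metis (mono_tags) IntD1 comp_apply g_def mem_Collect_eq)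
    moreover have "w = f (f w)" "f (f w) \<in> U"
      using w f(2) by simp_all
    ultimately show "w \<in> f ` (({x. c x \<noteq> x} - W') \<union> (W' \<inter> f -` U))"
      by blast
  qed
  then have "finite ({x. g x \<noteq> x} \<inter> U)"
    using cW fin_WU by (meson finite_UnI finite_imageI finite_subset)
  then have "g (to_circle \<zeta>) = to_circle \<zeta>"
    using fixes_if_near_fixed[OF \<open>g \<in> H\<close> U(1), of \<zeta> s0] U(2) s0(1,2) by (simp add: Z_def)
  then have "c x = x"
    using f(2) inj_mem[OF f(1)] by (simp add: g_def flip: \<zeta>)
  then have "to_circle (\<xi> + s) = to_circle \<xi>"
    using c(2) \<xi> by simp
  then have "\<xi> + s = \<xi>"
    using s(1) l by (intro to_circle_inj_near) (auto simp: lengths_def)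
  then show False
    using s(1) by (simp add: lengths_def)
qed

end

section \<open>One-sided limits of flips\<close>

text \<open>Shifted by a suitable integer, the lift takes its values in \<open>{u..v}\<close>; being
  increasing with dense range there, it must tend to the two ends.\<close>

lemma monotone_lift_limits:
  fixes F :: "real \<Rightarrow> circle" and h :: "real \<Rightarrow> real"
  assumes ab: "a < b" and uv: "u < v" "v < u + 1"
    and cont: "continuous_on {a<..<b} h" and mono: "strict_mono_on {a<..<b} h"
    and lift: "finite {t \<in> {a<..<b}. F t \<noteq> to_circle (h t)}"
    and into: "finite {t \<in> {a<..<b}. F t \<notin> Defs.arc u v}"
    and onto: "finite (Defs.arc u v - F ` {a<..<b})"
  shows "(F \<longlongrightarrow> to_circle u) (at_right a)" "(F \<longlongrightarrow> to_circle v) (at_left b)"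
proof -
  define T where "T = {a<..<b}"
  define E where "E = {t \<in> T. F t \<noteq> to_circle (h t)} \<union> {t \<in> T. F t \<notin> Defs.arc u v}"
  have E: "finite E" "E \<subseteq> T"
    using lift into by (auto simp: E_def T_def)
  have "infinite T"
    using ab by (simp add: T_def)
  then obtain t0 where t0: "t0 \<in> T" "t0 \<notin> E"
    using E by (metis finite_subset subsetI)
  have good: "\<exists>n::int. u < h t - of_int n \<and> h t - of_int n < v" if t: "t \<in> T" "t \<notin> E" for t
  proof -
    have "to_circle (h t) \<in> Defs.arc u v"
      using t by (auto simp: E_def)
    then obtain w where w: "to_circle (h t) = to_circle w" "u < w" "w < v"
      by (auto simp: Defs.arc_def)
    then obtain n where "h t - w = of_int n"
      by (auto simp: to_circle_eq_iff elim: Ints_cases)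
    then have "h t - of_int n = w"
      by simp
    then show ?thesis
      using w by metis
  qed
  obtain n :: int where n: "u < h t0 - of_int n" "h t0 - of_int n < v"
    using good[OF t0] by blast
  define k where "k = (\<lambda>t. h t - of_int n)"
  have ek: "to_circle (h t) = to_circle (k t)" for t
    by (simp add: k_def to_circle_eq_iff)
  have k_mono: "k s < k t" if "s \<in> T" "t \<in> T" "s < t" for s t
    using strict_mono_onD[OF mono] that by (simp add: k_def T_def)
  \<comment> \<open>Intermediate values: a connected range that left \<open>{u..v}\<close> would
    contain an interval inside a gap between integer translates of the arc, but values in a gap
    occur only on the finite set \<open>E\<close>.\<close>
  have kE: "w \<in> k ` E"
    if w: "x \<in> T" "y \<in> T" "k x \<le> w" "w \<le> k y" "v < w \<and> w < u + 1 \<or> v - 1 < w \<and> w < u" for x y w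
  proof -
    have "connected (k ` T)"
      unfolding k_def T_def by (intro connected_continuous_image continuous_intros cont) simp
    then have "{k x..k y} \<subseteq> k ` T"
      using w(1,2) by (intro connected_contains_Icc) auto
    then obtain t where t: "t \<in> T" "w = k t"
      using w(3,4) by auto
    have "t \<in> E"
    proof (rule ccontr)
      assume "t \<notin> E"
      then obtain i :: int where i: "u < h t - of_int i" "h t - of_int i < v"
        using good[OF t(1)] by blast
      define j where "j = n - i"
      have "h t - of_int i = w + of_int j"
        by (simp add: t(2) k_def j_def)
      then have j: "u < w + of_int j" "w + of_int j < v"
        using i by simp_all
      have "real_of_int j < 1" "- 1 < real_of_int j"
        using w(5) j uv by linarith+
      then have "j = 0"
        by linarith
      then show False
        using j w(5) by simp
    qed
    then show ?thesis
      using t by blast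
  qed
  have k_bounds: "u \<le> k t \<and> k t \<le> v" if t: "t \<in> T" for t
  proof (rule ccontr)
    assume "\<not> ?thesis"
    then consider "v < k t" | "k t < u"
      by linarith
    then show False
    proof cases
      case 1
      have "{v<..<min (k t) (u + 1)} \<subseteq> k ` E"
      proof
        fix w assume "w \<in> {v<..<min (k t) (u + 1)}"
        then show "w \<in> k ` E"
          using n by (intro kE[OF t0(1) t]) (auto simp: k_def)
      qed
      then have "finite {v<..<min (k t) (u + 1)}"
        using E(1) finite_subset by blast
      then show False
        using infinite_Ioo[of v "min (k t) (u + 1)"] 1 uv by simp
    next
      case 2
      have "{max (k t) (v - 1)<..<u} \<subseteq> k ` E"
      proof
        fix w assume "w \<in> {max (k t) (v - 1)<..<u}"
        then show "w \<in> k ` E"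
          using n by (intro kE[OF t t0(1)]) (auto simp: k_def)
      qed
      then have "finite {max (k t) (v - 1)<..<u}"
        using E(1) finite_subset by blast
      then show False
        using infinite_Ioo[of "max (k t) (v - 1)" u] 2 uv by simp
    qed
  qed
  \<comment> \<open>An open interval of values missed by \<open>k\<close> would give infinitely many
    points of the arc that \<open>F\<close> attains at most on \<open>E\<close>, against
    \<open>onto\<close>.\<close>
  have dense: "\<exists>t\<in>T. x < k t \<and> k t < y" if xy: "u \<le> x" "x < y" "y \<le> v" for x y
  proof (rule ccontr)
    assume none: "\<not> ?thesis"
    have "to_circle ` {x<..<y} \<subseteq> (Defs.arc u v - F ` T) \<union> F ` E"
    proof
      fix z assume "z \<in> to_circle ` {x<..<y}"
      then obtain w where w: "z = to_circle w" "x < w" "w < y"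
        by auto
      have "z \<in> Defs.arc u v"
        unfolding Defs.arc_def w(1) using w(2,3) xy by (intro imageI) auto
      moreover have "t \<in> E" if t: "t \<in> T" "z = F t" for t
      proof (rule ccontr)
        assume "t \<notin> E"
        then have "to_circle w = to_circle (k t)"
          using t w(1) ek by (simp add: E_def)
        moreover have "\<bar>w - k t\<bar> < 1"
          using k_bounds[OF t(1)] w xy uv by linarith
        ultimately have "w = k t"
          by (rule to_circle_inj_near)
        then show False
          using none t(1) w(2,3) by blast
      qed
      ultimately show "z \<in> (Defs.arc u v - F ` T) \<union> F ` E"
        by blast
    qed
    then have "finite (to_circle ` {x<..<y})"
      using onto E(1) by (auto simp: T_def intro: finite_subset)
    moreover have "inj_on to_circle {x<..<y}"
      using xy uv by (intro inj_on_to_circle_Ioo) simp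
    ultimately have "finite {x<..<y}"
      by (rule finite_imageD)
    then show False
      using infinite_Ioo[OF xy(2)] by simp
  qed
  have F_eq: "F t = to_circle (k t)" if "t \<in> T" "t \<notin> E" for t
    using that ek by (simp add: E_def)
  have k_right: "(k \<longlongrightarrow> u) (at_right a)"
  proof (rule tendstoI)
    fix e :: real assume "e > 0"
    then obtain t where t: "t \<in> T" "k t < min (u + e) v"
      using dense[of u "min (u + e) v"] uv by auto
    show "eventually (\<lambda>s. dist (k s) u < e) (at_right a)"
      unfolding eventually_at_right_field
    proof (intro exI[of _ t] conjI allI impI)
      show "a < t"
        using t(1) by (simp add: T_def)
      fix s assume s: "a < s" "s < t"
      then have sT: "s \<in> T"
        using t(1) by (simp add: T_def)
      have "u \<le> k s" "k s < k t"
        using k_bounds[OF sT] k_mono[OF sT t(1) s(2)] by auto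
      then show "dist (k s) u < e"
        using t(2) by (simp add: dist_real_def)
    qed
  qed
  have k_left: "(k \<longlongrightarrow> v) (at_left b)"
  proof (rule tendstoI)
    fix e :: real assume "e > 0"
    then obtain t where t: "t \<in> T" "max (v - e) u < k t"
      using dense[of "max (v - e) u" v] uv by auto
    show "eventually (\<lambda>s. dist (k s) v < e) (at_left b)"
      unfolding eventually_at_left_field
    proof (intro exI[of _ t] conjI allI impI)
      show "t < b"
        using t(1) by (simp add: T_def)
      fix s assume s: "s > t" "s < b"
      then have sT: "s \<in> T"
        using t(1) by (simp add: T_def)
      have "k s \<le> v" "k t < k s"
        using k_bounds[OF sT] k_mono[OF t(1) sT s(1)] by auto
      then show "dist (k s) v < e"
        using t(2) by (simp add: dist_real_def)
    qed
  qed
  have "eventually (\<lambda>t. to_circle (k t) = F t) (at_right a)"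
    unfolding eventually_at_right_field
  proof (intro exI[of _ "Min (insert b E)"] conjI allI impI)
    show "a < Min (insert b E)"
      using E ab by (auto simp: T_def)
    fix t assume "a < t" "t < Min (insert b E)"
    then have "t \<in> T" "t \<notin> E"
      using E(1) by (auto simp: T_def)
    then show "to_circle (k t) = F t"
      by (simp add: F_eq)
  qed
  moreover have "((\<lambda>t. to_circle (k t)) \<longlongrightarrow> to_circle u) (at_right a)"
    using k_right by (rule isCont_tendsto_compose[OF isCont_to_circle])
  ultimately show "(F \<longlongrightarrow> to_circle u) (at_right a)"
    by (metis (no_types) tendsto_cong)
  have "eventually (\<lambda>t. to_circle (k t) = F t) (at_left b)"
    unfolding eventually_at_left_field
  proof (intro exI[of _ "Max (insert a E)"] conjI allI impI)
    show "Max (insert a E) < b"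
      using E ab by (auto simp: T_def)
    fix t assume "t > Max (insert a E)" "t < b"
    then have "t \<in> T" "t \<notin> E"
      using E(1) by (auto simp: T_def)
    then show "to_circle (k t) = F t"
      by (simp add: F_eq)
  qed
  moreover have "((\<lambda>t. to_circle (k t)) \<longlongrightarrow> to_circle v) (at_left b)"
    using k_left by (rule isCont_tendsto_compose[OF isCont_to_circle])
  ultimately show "(F \<longlongrightarrow> to_circle v) (at_left b)"
    by (metis (no_types) tendsto_cong)
qed

text \<open>Reflecting the parameter reduces this to the increasing case and exchanges left and
  right limits.\<close>

lemma antimono_lift_limits:
  fixes F :: "real \<Rightarrow> circle" and h :: "real \<Rightarrow> real"
  assumes ab: "a < b" and uv: "u < v" "v < u + 1"
    and cont: "continuous_on {a<..<b} h" and mono: "strict_antimono_on {a<..<b} h"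
    and lift: "finite {t \<in> {a<..<b}. F t \<noteq> to_circle (h t)}"
    and into: "finite {t \<in> {a<..<b}. F t \<notin> Defs.arc u v}"
    and onto: "finite (Defs.arc u v - F ` {a<..<b})"
  shows "(F \<longlongrightarrow> to_circle v) (at_right a)" "(F \<longlongrightarrow> to_circle u) (at_left b)"
proof -
  have fin: "finite {t \<in> {- b<..<- a}. Q (- t)}" if "finite {t \<in> {a<..<b}. Q t}" for Q :: "real \<Rightarrow> bool"
  proof -
    have "{t \<in> {- b<..<- a}. Q (- t)} = uminus ` {t \<in> {a<..<b}. Q t}"
      by (force simp: image_iff)
    then show ?thesis
      using that by simp
  qed
  have "continuous_on {- b<..<- a} (\<lambda>t. h (- t))"
    by (rule continuous_on_compose2[OF cont]) (auto intro!: continuous_intros)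
  moreover have "strict_mono_on {- b<..<- a} (\<lambda>t. h (- t))"
    using mono by (auto simp: monotone_on_def)
  moreover have "(\<lambda>t. F (- t)) ` {- b<..<- a} = F ` uminus ` {- b<..<- a}"
    by (simp only: image_image)
  then have "finite (Defs.arc u v - (\<lambda>t. F (- t)) ` {- b<..<- a})"
    using onto by simp
  moreover have "- b < - a"
    using ab by simp
  ultimately have "((\<lambda>t. F (- t)) \<longlongrightarrow> to_circle u) (at_right (- b))"
    "((\<lambda>t. F (- t)) \<longlongrightarrow> to_circle v) (at_left (- a))"
    using monotone_lift_limits[OF _ uv _ _ fin[OF lift] fin[OF into]] by blast+
  then show "(F \<longlongrightarrow> to_circle v) (at_right a)" "(F \<longlongrightarrow> to_circle u) (at_left b)"
    by (simp_all add: at_right_minus[of a] at_left_minus[of b] filterlim_filtermap)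
qed

section \<open>Limits of a representative at the ends and inside the arcs\<close>

lemma piece_finite:
  assumes "inj g" "b \<le> a + 1" "finite (g ` Defs.arc a b - J)"
  shows "finite {t \<in> {a<..<b}. g (to_circle t) \<notin> J}"
proof (rule finite_imageD)
  show "finite ((\<lambda>t. g (to_circle t)) ` {t \<in> {a<..<b}. g (to_circle t) \<notin> J})"
    by (rule finite_subset[OF _ assms(3)]) (auto simp: Defs.arc_def)
  show "inj_on (\<lambda>t. g (to_circle t)) {t \<in> {a<..<b}. g (to_circle t) \<notin> J}"
    using inj_on_to_circle_Ioo[OF assms(2)] assms(1) by (auto simp: inj_on_def inj_def)
qed

lemma orientation_preserving_limits:
  assumes g: "g \<in> f" "inj g" and ab: "a < b" "b \<le> a + 1" and uv: "u < v" "v < u + 1"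
    and f: "orientation_preserving_on f a b" "image_eq_mod_finite f (Defs.arc a b) (Defs.arc u v)"
  shows "((\<lambda>t. g (to_circle t)) \<longlongrightarrow> to_circle u) (at_right a)"
    "((\<lambda>t. g (to_circle t)) \<longlongrightarrow> to_circle v) (at_left b)"
proof -
  obtain h where h: "continuous_on {a<..<b} h" "strict_mono_on {a<..<b} h"
    "finite {t \<in> {a<..<b}. g (to_circle t) \<noteq> to_circle (h t)}"
    using f(1) g(1) by (auto simp: orientation_preserving_on_def lifts_on_def)
  have J: "finite (g ` Defs.arc a b - Defs.arc u v)" "finite (Defs.arc u v - (\<lambda>t. g (to_circle t)) ` {a<..<b})"
    using f(2) g(1) by (auto simp: image_eq_mod_finite_def Defs.arc_def image_image)
  show "((\<lambda>t. g (to_circle t)) \<longlongrightarrow> to_circle u) (at_right a)"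
    "((\<lambda>t. g (to_circle t)) \<longlongrightarrow> to_circle v) (at_left b)"
    using monotone_lift_limits[OF ab(1) uv h piece_finite[OF g(2) ab(2) J(1)] J(2)] by auto
qed

lemma orientation_reversing_limits:
  assumes g: "g \<in> f" "inj g" and ab: "a < b" "b \<le> a + 1" and uv: "u < v" "v < u + 1"
    and f: "orientation_reversing_on f a b" "image_eq_mod_finite f (Defs.arc a b) (Defs.arc u v)"
  shows "((\<lambda>t. g (to_circle t)) \<longlongrightarrow> to_circle v) (at_right a)"
    "((\<lambda>t. g (to_circle t)) \<longlongrightarrow> to_circle u) (at_left b)"
proof -
  obtain h where h: "continuous_on {a<..<b} h" "strict_antimono_on {a<..<b} h"
    "finite {t \<in> {a<..<b}. g (to_circle t) \<noteq> to_circle (h t)}"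
    using f(1) g(1) by (auto simp: orientation_reversing_on_def lifts_on_def)
  have J: "finite (g ` Defs.arc a b - Defs.arc u v)" "finite (Defs.arc u v - (\<lambda>t. g (to_circle t)) ` {a<..<b})"
    using f(2) g(1) by (auto simp: image_eq_mod_finite_def Defs.arc_def image_image)
  show "((\<lambda>t. g (to_circle t)) \<longlongrightarrow> to_circle v) (at_right a)"
    "((\<lambda>t. g (to_circle t)) \<longlongrightarrow> to_circle u) (at_left b)"
    using antimono_lift_limits[OF ab(1) uv h piece_finite[OF g(2) ab(2) J(1)] J(2)] by auto
qed

lemma lifts_on_limit:
  assumes "g \<in> f" "lifts_on f a b h" "a < t" "t < b"
  shows "((\<lambda>t. g (to_circle t)) \<longlongrightarrow> to_circle (h t)) (at t)"
proof -
  define E where "E = {t \<in> {a<..<b}. g (to_circle t) \<noteq> to_circle (h t)}"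
  have "finite E" "continuous_on {a<..<b} h"
    using assms(1,2) by (auto simp: lifts_on_def E_def)
  then have "isCont h t"
    using assms(3,4) by (simp add: continuous_on_eq_continuous_at)
  then have lim: "((\<lambda>s. to_circle (h s)) \<longlongrightarrow> to_circle (h t)) (at t)"
    unfolding isCont_def by (rule isCont_tendsto_compose[OF isCont_to_circle])
  have "open ({a<..<b} - (E - {t}))"
    using \<open>finite E\<close> by (intro open_Diff finite_imp_closed) auto
  then have "eventually (\<lambda>s. s \<in> {a<..<b} - (E - {t}) - {t}) (at t)"
    by (rule eventually_at_in_open) (use assms(3,4) in auto)
  then have "eventually (\<lambda>s. to_circle (h s) = g (to_circle s)) (at t)"
    by eventually_elim (auto simp: E_def)
  then show ?thesis
    using lim by (metis (no_types) tendsto_cong)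
qed

lemma orientation_limit:
  assumes "g \<in> f" "orientation_preserving_on f a b \<or> orientation_reversing_on f a b" "a < t" "t < b"
  shows "\<exists>z. ((\<lambda>t. g (to_circle t)) \<longlongrightarrow> z) (at t)"
  using assms lifts_on_limit
  unfolding orientation_preserving_on_def orientation_reversing_on_def by metis

text \<open>Separating \<open>z\<close> from both limits leaves, on a neighbourhood of
  \<open>t\<close>, at most the point itself with value near \<open>z\<close>, against the infinity
  required of a cluster value.\<close>

lemma cluster_one_sided_limits:
  assumes "((\<lambda>t. f (to_circle t)) \<longlongrightarrow> z1) (at_left t)" "((\<lambda>t. f (to_circle t)) \<longlongrightarrow> z2) (at_right t)"
    and cl: "cluster f (to_circle t) (z :: circle)"
  shows "z = z1 \<or> z = z2"
proof (rule ccontr)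
  assume z: "\<not> ?thesis"
  obtain V1 U1 where 1: "open V1" "open U1" "z1 \<in> V1" "z \<in> U1" "V1 \<inter> U1 = {}"
    using z hausdorff[of z1 z] by metis
  obtain V2 U2 where 2: "open V2" "open U2" "z2 \<in> V2" "z \<in> U2" "V2 \<inter> U2 = {}"
    using z hausdorff[of z2 z] by metis
  have "eventually (\<lambda>s. f (to_circle s) \<notin> U1 \<inter> U2) (at_left t)"
    using topological_tendstoD[OF assms(1) 1(1,3)] by eventually_elim (use 1(5) in auto)
  moreover have "eventually (\<lambda>s. f (to_circle s) \<notin> U1 \<inter> U2) (at_right t)"
    using topological_tendstoD[OF assms(2) 2(1,3)] by eventually_elim (use 2(5) in auto)
  ultimately have "eventually (\<lambda>s. f (to_circle s) \<notin> U1 \<inter> U2) (at t)"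
    by (simp add: eventually_at_split)
  then obtain S where S: "open S" "t \<in> S" "\<forall>s\<in>S. s \<noteq> t \<longrightarrow> f (to_circle s) \<notin> U1 \<inter> U2"
    unfolding eventually_at_topological by blast
  have "to_circle ` S \<inter> f -` (U1 \<inter> U2) \<subseteq> {to_circle t}"
    using S(3) by auto
  then have "finite (to_circle ` S \<inter> f -` (U1 \<inter> U2))"
    using finite_subset by blast
  moreover have "open (to_circle ` S)" "to_circle t \<in> to_circle ` S" "open (U1 \<inter> U2)" "z \<in> U1 \<inter> U2"
    using S 1 2 by (auto intro: open_to_circle_image)
  ultimately show False
    using cl unfolding cluster_def by blast
qed

text \<open>By the cluster property an involution behaving like a flip permutes the three end points of
  its intervals without fixed point, which is impossible.\<close>

lemma (in dense_rotations) no_flip: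
  assumes f: "f \<in> H" "\<And>x. f (f x) = x" and abc: "a' < b'" "b' < c'" "c' < a' + 1"
    and right: "((\<lambda>t. f (to_circle t)) \<longlongrightarrow> to_circle b') (at_right a')"
      "((\<lambda>t. f (to_circle t)) \<longlongrightarrow> to_circle c') (at_right b')"
      "((\<lambda>t. f (to_circle t)) \<longlongrightarrow> y) (at_right c')"
    and left: "((\<lambda>t. f (to_circle t)) \<longlongrightarrow> to_circle a') (at_left b')"
      "((\<lambda>t. f (to_circle t)) \<longlongrightarrow> z) (at_left c')"
      "((\<lambda>t. f (to_circle t)) \<longlongrightarrow> to_circle c') (at_left (a' + 1))"
    and yz: "{y, z} = {to_circle a', to_circle b'}"
    and inner: "\<And>t. t \<in> {a'<..<b'} \<union> {b'<..<c'} \<union> {c'<..<a' + 1} \<Longrightarrow>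
      \<exists>w. ((\<lambda>t. f (to_circle t)) \<longlongrightarrow> w) (at t)"
  shows False
proof -
  have periodic: "to_circle (t - 1) = to_circle t" for t
    by (simp add: to_circle_eq_iff)
  have "at_left a' = filtermap (\<lambda>t. t - 1) (at_left (a' + 1))"
    by (simp add: filtermap_at_left_shift)
  then have left_a: "((\<lambda>t. f (to_circle t)) \<longlongrightarrow> to_circle c') (at_left a')"
    using left(3) by (simp add: filterlim_filtermap periodic)
  have fin: "finite {w. cluster f x w}" for x
  proof -
    obtain t where t: "x = to_circle t" "a' \<le> t" "t < a' + 1"
      by (rule to_circle_cases_Ico)
    have "\<exists>z1 z2. ((\<lambda>t. f (to_circle t)) \<longlongrightarrow> z1) (at_left t) \<and> ((\<lambda>t. f (to_circle t)) \<longlongrightarrow> z2) (at_right t)"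
    proof -
      consider "t = a'" | "t = b'" | "t = c'" | "t \<in> {a'<..<b'} \<union> {b'<..<c'} \<union> {c'<..<a' + 1}"
        using t(2,3) by force
      then show ?thesis
      proof cases
        case 4
        then show ?thesis
          using inner filterlim_at_split by blast
      qed (use left_a left right in blast)+
    qed
    then obtain z1 z2 where "((\<lambda>t. f (to_circle t)) \<longlongrightarrow> z1) (at_left t)"
      "((\<lambda>t. f (to_circle t)) \<longlongrightarrow> z2) (at_right t)"
      by blast
    then have "{w. cluster f x w} \<subseteq> {z1, z2}"
      using cluster_one_sided_limits t(1) by blast
    then show ?thesis
      using finite_subset by blast
  qed
  have cl: "cluster f x (f x)" for x
    by (rule involution_cluster[OF f fin])
  have distinct: "to_circle a' \<noteq> to_circle b'" "to_circle b' \<noteq> to_circle c'" "to_circle a' \<noteq> to_circle c'"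
    using abc by (auto dest!: to_circle_inj_near)
  \<comment> \<open>Every end point is sent to one of its one-sided limits, which are end points
    other than itself. By parity an involution of three points has a fixed point.\<close>
  have "f (to_circle a') \<in> {to_circle b', to_circle c'}"
    using cluster_one_sided_limits[OF left_a right(1) cl] by auto
  moreover have "f (to_circle b') \<in> {to_circle a', to_circle c'}"
    using cluster_one_sided_limits[OF left(1) right(2) cl] by auto
  moreover have "f (to_circle c') \<in> {to_circle a', to_circle b'}"
    using cluster_one_sided_limits[OF left(2) right(3) cl] yz by auto
  ultimately show False
    using distinct f(2) by (metis empty_iff insert_iff)
qed

text \<open>Both kinds of flips have the same one-sided limits at the first two end points. At the
  third one the limits are the first two end points, in opposite orders; the set equality for
  \<open>y\<close> and \<open>z\<close> in \<open>no_flip\<close> covers both.\<close>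

lemma (in dense_rotations) no_flip_mem:
  assumes g: "g \<in> H" "\<And>x. g (g x) = x" "g \<in> f"
  shows "\<not> flip_132 f" "\<not> triple_flip f"
proof -
  have inj: "inj g"
    using bij_mem[OF g(1)] by (rule bij_is_inj)
  have per: "to_circle (t + 1) = to_circle t" for t
    by (simp add: to_circle_eq_iff)
  show "\<not> flip_132 f"
  proof
    assume "flip_132 f"
    then obtain p q r where pqr: "p < q" "q < r" "r < p + 1"
      and im: "image_eq_mod_finite f (Defs.arc p q) (Defs.arc p q)"
        "image_eq_mod_finite f (Defs.arc q r) (Defs.arc r (p + 1))"
        "image_eq_mod_finite f (Defs.arc r (p + 1)) (Defs.arc q r)"
      and ori: "orientation_reversing_on f p q" "orientation_preserving_on f q r"
        "orientation_preserving_on f r (p + 1)"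
      unfolding flip_132_def by blast
    note lim1 = orientation_reversing_limits[OF g(3) inj _ _ _ _ ori(1) im(1)]
    note lim2 = orientation_preserving_limits[OF g(3) inj _ _ _ _ ori(2) im(2)]
    note lim3 = orientation_preserving_limits[OF g(3) inj _ _ _ _ ori(3) im(3)]
    show False
    proof (rule no_flip[OF g(1,2) pqr])
      show "((\<lambda>t. g (to_circle t)) \<longlongrightarrow> to_circle q) (at_right p)"
        "((\<lambda>t. g (to_circle t)) \<longlongrightarrow> to_circle p) (at_left q)"
        using lim1 pqr by auto
      show "((\<lambda>t. g (to_circle t)) \<longlongrightarrow> to_circle r) (at_right q)"
        "((\<lambda>t. g (to_circle t)) \<longlongrightarrow> to_circle p) (at_left r)"
        using lim2 pqr by (auto simp: per)
      show "((\<lambda>t. g (to_circle t)) \<longlongrightarrow> to_circle q) (at_right r)"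
        "((\<lambda>t. g (to_circle t)) \<longlongrightarrow> to_circle r) (at_left (p + 1))"
        using lim3 pqr by auto
      show "\<exists>w. ((\<lambda>t. g (to_circle t)) \<longlongrightarrow> w) (at t)"
        if "t \<in> {p<..<q} \<union> {q<..<r} \<union> {r<..<p + 1}" for t
        using that orientation_limit[OF g(3)] ori by fastforce
    qed auto
  qed
  show "\<not> triple_flip f"
  proof
    assume "triple_flip f"
    then obtain p q r where pqr: "p < q" "q < r" "r < p + 1"
      and pieces: "\<forall>(u, v) \<in> {(p, q), (q, r), (r, p + 1)}.
        image_eq_mod_finite f (Defs.arc u v) (Defs.arc u v) \<and> orientation_reversing_on f u v"
      unfolding triple_flip_def by blast
    then have ori: "orientation_reversing_on f p q" "orientation_reversing_on f q r"
        "orientation_reversing_on f r (p + 1)"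
      by auto
    have lim: "((\<lambda>t. g (to_circle t)) \<longlongrightarrow> to_circle v) (at_right u)"
      "((\<lambda>t. g (to_circle t)) \<longlongrightarrow> to_circle u) (at_left v)"
      if "(u, v) \<in> {(p, q), (q, r), (r, p + 1)}" for u v
    proof -
      have uv: "u < v" "v \<le> u + 1" "v < u + 1"
        using that pqr by auto
      have "orientation_reversing_on f u v" "image_eq_mod_finite f (Defs.arc u v) (Defs.arc u v)"
        using pieces that by blast+
      from orientation_reversing_limits[OF g(3) inj uv(1,2) uv(1,3) this]
      show "((\<lambda>t. g (to_circle t)) \<longlongrightarrow> to_circle v) (at_right u)"
        "((\<lambda>t. g (to_circle t)) \<longlongrightarrow> to_circle u) (at_left v)" .
    qed
    show False
    proof (rule no_flip[OF g(1,2) pqr])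
      show "((\<lambda>t. g (to_circle t)) \<longlongrightarrow> to_circle q) (at_right p)"
        "((\<lambda>t. g (to_circle t)) \<longlongrightarrow> to_circle p) (at_left q)"
        "((\<lambda>t. g (to_circle t)) \<longlongrightarrow> to_circle r) (at_right q)"
        "((\<lambda>t. g (to_circle t)) \<longlongrightarrow> to_circle q) (at_left r)"
        "((\<lambda>t. g (to_circle t)) \<longlongrightarrow> to_circle r) (at_left (p + 1))"
        by (intro lim; simp)+
      show "((\<lambda>t. g (to_circle t)) \<longlongrightarrow> to_circle p) (at_right r)"
        using lim(1)[of r "p + 1"] by (simp add: per)
      show "\<exists>w. ((\<lambda>t. g (to_circle t)) \<longlongrightarrow> w) (at t)"
        if "t \<in> {p<..<q} \<union> {q<..<r} \<union> {r<..<p + 1}" for t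
        using that orientation_limit[OF g(3)] ori by fastforce
    qed auto
  qed
qed

section \<open>Realizations\<close>

definition circle_rotations :: "(circle \<Rightarrow> circle) set set \<Rightarrow> circle set" where
  "circle_rotations \<Lambda> = {t. proj_PC (rotation t) \<in> \<Lambda>}"

lemma proj_rotation_add: "proj_PC (rotation (s + t)) = proj_PC (rotation s) \<otimes>\<^bsub>PC\<^esub> proj_PC (rotation t)"
  by (simp add: rotation_add proj_PC_comp rotation_in_PC_hat)

lemma proj_rotation_in_PC: "proj_PC (rotation t) \<in> carrier PC"
  using proj_PC_hom rotation_in_PC_hat by (auto simp: hom_def)

lemma proj_rotation_minus: "inv\<^bsub>PC\<^esub> proj_PC (rotation t) = proj_PC (rotation (- t))"
  by (rule group.inv_equality[OF PC.is_group])
     (simp_all add: proj_rotation_in_PC rotation_0 one_PC flip: proj_rotation_add)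

lemma comm_group_rotations:
  assumes "subgroup \<Lambda> PC" "\<Lambda> \<subseteq> rotations"
  shows "comm_group (PC\<lparr>carrier := \<Lambda>\<rparr>)"
proof (rule group.group_comm_groupI)
  show "group (PC\<lparr>carrier := \<Lambda>\<rparr>)"
    using PC.subgroup_imp_group[OF assms(1)] .
  fix x y assume "x \<in> carrier (PC\<lparr>carrier := \<Lambda>\<rparr>)" "y \<in> carrier (PC\<lparr>carrier := \<Lambda>\<rparr>)"
  then have "x \<in> rotations" "y \<in> rotations"
    using assms(2) by auto
  then obtain s t where "x = proj_PC (rotation s)" "y = proj_PC (rotation t)"
    by (auto simp: rotations_def)
  then show "x \<otimes>\<^bsub>PC\<lparr>carrier := \<Lambda>\<rparr>\<^esub> y = y \<otimes>\<^bsub>PC\<lparr>carrier := \<Lambda>\<rparr>\<^esub> x"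
    by (simp add: add.commute flip: proj_rotation_add)
qed

lemma infinite_index_rotation:
  assumes \<Lambda>: "subgroup \<Lambda> PC" "\<Lambda> \<subseteq> rotations"
    and rank: "Q_rank (PC\<lparr>carrier := \<Lambda>\<rparr>) \<ge> 2 \<or>
      \<not> finitely_generated (PC\<lparr>carrier := \<Lambda>\<rparr>) \<and> Q_rank (PC\<lparr>carrier := \<Lambda>\<rparr>) = 1"
  obtains \<theta> where "to_circle \<theta> \<in> circle_rotations \<Lambda>"
    "\<And>n::nat. n > 0 \<Longrightarrow> to_circle (of_nat n * \<theta>) \<noteq> 0"
    "\<And>Y. finite Y \<Longrightarrow> \<exists>t\<in>circle_rotations \<Lambda>. \<forall>y\<in>Y. \<forall>k::int. t \<noteq> y + to_circle (of_int k * \<theta>)"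
proof -
  interpret \<Lambda>: comm_group "PC\<lparr>carrier := \<Lambda>\<rparr>"
    by (rule comm_group_rotations[OF \<Lambda>])
  obtain x where x: "x \<in> \<Lambda>"
    and tf: "\<And>n::nat. n > 0 \<Longrightarrow> x [^]\<^bsub>PC\<lparr>carrier := \<Lambda>\<rparr>\<^esub> n \<noteq> \<one>\<^bsub>PC\<^esub>"
    and index: "\<And>X. finite X \<Longrightarrow> X \<subseteq> \<Lambda> \<Longrightarrow>
      \<exists>z\<in>\<Lambda>. \<forall>y\<in>X. \<forall>k::int. z \<noteq> y \<otimes>\<^bsub>PC\<^esub> x [^]\<^bsub>PC\<lparr>carrier := \<Lambda>\<rparr>\<^esub> k"
    using \<Lambda>.infinite_index_of_Q_rank[OF rank] by simp metis
  obtain \<theta> where \<theta>: "x = proj_PC (rotation (to_circle \<theta>))"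
  proof -
    obtain t where "x = proj_PC (rotation t)"
      using x \<Lambda>(2) by (auto simp: rotations_def)
    then show ?thesis
      using that to_circle_cases[of t] by blast
  qed
  have pow: "x [^]\<^bsub>PC\<lparr>carrier := \<Lambda>\<rparr>\<^esub> n = proj_PC (rotation (to_circle (of_nat n * \<theta>)))" for n :: nat
    by (induction n)
       (simp_all add: one_PC rotation_0 id_def \<theta> distrib_right to_circle_add add.commute flip: proj_rotation_add)
  have ipow: "x [^]\<^bsub>PC\<lparr>carrier := \<Lambda>\<rparr>\<^esub> k = proj_PC (rotation (to_circle (of_int k * \<theta>)))" for k :: int
  proof (cases k rule: int_cases4)
    case (nonneg n)
    then show ?thesis
      using pow[of n] by (simp add: int_pow_int)
  next
    case (neg n)
    have "x [^]\<^bsub>PC\<lparr>carrier := \<Lambda>\<rparr>\<^esub> n \<in> \<Lambda>"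
      using \<Lambda>.nat_pow_closed[of x n] x by simp
    then have "inv\<^bsub>PC\<lparr>carrier := \<Lambda>\<rparr>\<^esub> (x [^]\<^bsub>PC\<lparr>carrier := \<Lambda>\<rparr>\<^esub> n)
        = inv\<^bsub>PC\<^esub> (x [^]\<^bsub>PC\<lparr>carrier := \<Lambda>\<rparr>\<^esub> n)"
      by (rule PC.m_inv_consistent[OF \<Lambda>(1)])
    then show ?thesis
      using x by (simp add: neg \<Lambda>.int_pow_neg_int pow proj_rotation_minus to_circle_minus)
  qed
  show thesis
  proof
    show "to_circle \<theta> \<in> circle_rotations \<Lambda>"
      using x \<theta> by (simp add: circle_rotations_def)
    show "to_circle (of_nat n * \<theta>) \<noteq> 0" if "n > 0" for n :: nat
    proof
      assume "to_circle (of_nat n * \<theta>) = 0"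
      then have "x [^]\<^bsub>PC\<lparr>carrier := \<Lambda>\<rparr>\<^esub> n = \<one>\<^bsub>PC\<^esub>"
        by (simp add: pow one_PC rotation_0)
      then show False
        using tf[OF that] by simp
    qed
    show "\<exists>t\<in>circle_rotations \<Lambda>. \<forall>y\<in>Y. \<forall>k::int. t \<noteq> y + to_circle (of_int k * \<theta>)" if "finite Y" for Y
    proof -
      \<comment> \<open>Only those \<open>y\<close> that are angles of \<Lambda> represent cosets
        inside \<Lambda>. For the others the equation is impossible, since solving it for
        \<open>y\<close> would exhibit \<open>y\<close> as an angle of \<Lambda>.\<close>
      define X where "X = (\<lambda>t. proj_PC (rotation t)) ` (Y \<inter> circle_rotations \<Lambda>)"
      have "finite X" "X \<subseteq> \<Lambda>"
        using that by (auto simp: X_def circle_rotations_def)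
      from index[OF this] obtain z where z: "z \<in> \<Lambda>"
        "\<forall>y\<in>X. \<forall>k::int. z \<noteq> y \<otimes>\<^bsub>PC\<^esub> x [^]\<^bsub>PC\<lparr>carrier := \<Lambda>\<rparr>\<^esub> k"
        by blast
      obtain t where t: "z = proj_PC (rotation t)"
        using z(1) \<Lambda>(2) by (auto simp: rotations_def)
      have "t \<noteq> y + to_circle (of_int k * \<theta>)" if "y \<in> Y" for y and k :: int
      proof
        assume eq: "t = y + to_circle (of_int k * \<theta>)"
        then have z_eq: "z = proj_PC (rotation y) \<otimes>\<^bsub>PC\<^esub> x [^]\<^bsub>PC\<lparr>carrier := \<Lambda>\<rparr>\<^esub> k"
          by (simp add: t ipow proj_rotation_add)
        have "y = t + to_circle (of_int (- k) * \<theta>)"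
          by (simp add: eq to_circle_minus)
        then have "proj_PC (rotation y) = z \<otimes>\<^bsub>PC\<^esub> x [^]\<^bsub>PC\<lparr>carrier := \<Lambda>\<rparr>\<^esub> (- k)"
          by (simp only: t ipow proj_rotation_add)
        moreover have "x [^]\<^bsub>PC\<lparr>carrier := \<Lambda>\<rparr>\<^esub> (- k) \<in> \<Lambda>"
          using \<Lambda>.int_pow_closed[of x "- k"] x by simp
        ultimately have "proj_PC (rotation y) \<in> \<Lambda>"
          using z(1) subgroup.m_closed[OF \<Lambda>(1)] by simp
        then have "proj_PC (rotation y) \<in> X"
          using that by (auto simp: X_def circle_rotations_def)
        then show False
          using z(2) z_eq by blast
      qed
      moreover have "t \<in> circle_rotations \<Lambda>"
        using z(1) t by (simp add: circle_rotations_def)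
      ultimately show ?thesis
        by blast
    qed
  qed
qed

text \<open>Meant for a \<open>q\<close> known only through its coset, such as a partial rotation:
  \<open>h\<close> is \<open>q\<close> followed by a finitely supported permutation, and
  \<open>q\<close> inherits injectivity from \<open>h\<close>.\<close>

lemma near_if_proj_PC_eq:
  assumes "h \<in> carrier PC_hat" "proj_PC h = proj_PC q"
  shows "near h q"
proof -
  have h: "bij h"
    using assms(1) by (simp add: in_carrier_PC_hat)
  then have "h \<in> proj_PC q"
    using in_proj_PC_iff[OF assms(1)] assms(2) by auto
  then obtain k where k: "bij k" "near k id" "h = k \<circ> q"
    by (auto simp: proj_PC_def r_coset_def fin_supp_perms_iff)
  have "inj q"
    using h k(3) by (metis bij_is_inj inj_on_imageI2)
  then show ?thesis
    using near_comp[OF k(2) near_refl[of q]] k(3) by simp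
qed

lemma lifted_group_realization:
  assumes H: "subgroup H PC_hat" "inj_on proj_PC H"
  shows "lifted_group H"
proof
  have sub: "h \<in> carrier PC_hat" if "h \<in> H" for h
    using subgroup.subset[OF H(1)] that by blast
  show "id \<in> H"
    using subgroup.one_closed[OF H(1)] by simp
  show "bij g" if "g \<in> H" for g
    using sub[OF that] by (simp add: in_carrier_PC_hat)
  show "g \<circ> h \<in> H" if "g \<in> H" "h \<in> H" for g h
    using subgroup.m_closed[OF H(1) that] by simp
  show "inv_into UNIV g \<in> H" if "g \<in> H" for g
    using subgroup.m_inv_closed[OF H(1) that] m_inv_PC_hat[OF sub[OF that]] by simp
  show "g = h" if "g \<in> H" "h \<in> H" "near g h" for g h
    using that H(2) sub proj_PC_eq_iff by (metis inj_onD)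
qed

lemma dense_rotations_conj:
  assumes H: "subgroup H PC_hat" "bij_betw proj_PC H \<Gamma>"
    and \<Lambda>: "subgroup \<Lambda> PC" "\<Lambda> \<subseteq> \<Gamma>" "\<Lambda> \<subseteq> rotations"
    and rank: "Q_rank (PC\<lparr>carrier := \<Lambda>\<rparr>) \<ge> 2 \<or>
      \<not> finitely_generated (PC\<lparr>carrier := \<Lambda>\<rparr>) \<and> Q_rank (PC\<lparr>carrier := \<Lambda>\<rparr>) = 1"
    and P: "0 < l" "l < 1" "P \<subseteq> \<Gamma>" "dense_in_partial_rotations a l P"
  obtains \<phi> where "bij \<phi>" "near \<phi> id"
    "dense_rotations ((\<lambda>h. inv_into UNIV \<phi> \<circ> h \<circ> \<phi>) ` H) a l"
proof -
  have lg: "lifted_group H"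
    using H by (intro lifted_group_realization) (auto simp: bij_betw_def)
  then interpret lifted_group H .
  have lift: "\<exists>h\<in>H. near h q" if "proj_PC q \<in> \<Gamma>" for q
  proof -
    from that obtain h where "h \<in> H" "proj_PC h = proj_PC q"
      using H(2) by (auto simp: bij_betw_def)
    then show ?thesis
      using near_if_proj_PC_eq subgroup.subset[OF H(1)] by blast
  qed
  obtain \<theta> where \<theta>: "to_circle \<theta> \<in> circle_rotations \<Lambda>"
    and tf: "\<And>n::nat. n > 0 \<Longrightarrow> to_circle (of_nat n * \<theta>) \<noteq> 0"
    and index: "\<And>Y. finite Y \<Longrightarrow>
      \<exists>t\<in>circle_rotations \<Lambda>. \<forall>y\<in>Y. \<forall>k::int. t \<noteq> y + to_circle (of_int k * \<theta>)"
    using infinite_index_rotation[OF \<Lambda>(1,3) rank] by metis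
  have add: "s + t \<in> circle_rotations \<Lambda>" if "s \<in> circle_rotations \<Lambda>" "t \<in> circle_rotations \<Lambda>" for s t
    using that subgroup.m_closed[OF \<Lambda>(1)] by (simp add: circle_rotations_def proj_rotation_add)
  have minus: "- t \<in> circle_rotations \<Lambda>" if "t \<in> circle_rotations \<Lambda>" for t
    using that subgroup.m_inv_closed[OF \<Lambda>(1)] by (auto simp: circle_rotations_def simp flip: proj_rotation_minus)
  have "\<exists>h\<in>H. near h (rotation t)" if "t \<in> circle_rotations \<Lambda>" for t
    using that \<Lambda>(2) by (intro lift) (auto simp: circle_rotations_def)
  from straighten_rotations[OF lg add minus this \<theta> tf index]
  obtain \<phi> where \<phi>: "bij \<phi>" "near \<phi> id"
    and conj: "\<And>t. t \<in> circle_rotations \<Lambda> \<Longrightarrow> \<exists>h\<in>H. h \<circ> \<phi> = \<phi> \<circ> rotation t"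
    by blast
  let ?K = "\<lambda>h. inv_into UNIV \<phi> \<circ> h \<circ> \<phi>"
  have rot: "rotation t \<in> ?K ` H" if "t \<in> circle_rotations \<Lambda>" for t
  proof -
    obtain h where h: "h \<in> H" "h \<circ> \<phi> = \<phi> \<circ> rotation t"
      using conj[OF \<open>t \<in> _\<close>] by blast
    have "?K h = rotation t"
      using \<phi>(1) by (simp add: comp_assoc h(2)) (simp add: bij_is_inj flip: comp_assoc)
    then show ?thesis
      using h(1) by (metis imageI)
  qed
  have \<theta>_mult: "to_circle (of_int k * \<theta>) \<in> circle_rotations \<Lambda>" for k
  proof -
    have "0 \<in> circle_rotations \<Lambda>"
      using add[OF \<theta> minus[OF \<theta>]] by simp
    then have "to_circle (of_nat n * \<theta>) \<in> circle_rotations \<Lambda>" for n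
      by (induction n) (simp_all add: distrib_right to_circle_add add \<theta>)
    then show ?thesis
      by (cases k rule: int_cases2) (simp_all add: to_circle_minus minus)
  qed
  \<comment> \<open>A rational \<theta> would have a positive multiple that vanishes on the circle.
    Irrationality yields density of the multiples modulo 1, hence genuine rotations by a dense set
    of angles.\<close>
  have "\<theta> \<notin> \<rat>"
  proof
    assume "\<theta> \<in> \<rat>"
    then obtain p q :: int where pq: "q > 0" "\<theta> = of_int p / of_int q"
      by (rule Rats_cases') auto
    then have "of_nat (nat q) * \<theta> = of_int p"
      by simp
    then show False
      using tf[of "nat q"] pq(1) by simp
  qed
  have "dense_rotations (?K ` H) a l"
  proof (rule dense_rotations.intro)
    show "lifted_group (?K ` H)"
      by (rule lifted_group_conj[OF \<phi>])
    show "dense_rotations_axioms (?K ` H) a l"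
    proof
      fix u v :: real assume uv: "u < v"
      obtain h k :: int where hk: "\<bar>of_int k * \<theta> - of_int h - (u + v) / 2\<bar> < (v - u) / 2"
      proof (rule sequence_of_fractional_parts_is_dense)
        show "(v - u) / 2 > 0"
          using uv by simp
      qed (use \<open>\<theta> \<notin> \<rat>\<close> in blast)+
      have "to_circle (of_int k * \<theta> - of_int h) = to_circle (of_int k * \<theta>)"
        by (simp add: to_circle_eq_iff)
      then have "rotation (to_circle (of_int k * \<theta> - of_int h)) \<in> ?K ` H"
        using rot[OF \<theta>_mult] by metis
      moreover have "u < of_int k * \<theta> - of_int h" "of_int k * \<theta> - of_int h < v"
        using hk by (simp_all add: abs_less_iff field_simps)
      ultimately show "\<exists>t. rotation (to_circle t) \<in> ?K ` H \<and> u < t \<and> t < v"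
        by blast
      have "{u<..<v} \<inter> closure {s. proj_PC (partial_rotation a l s) \<in> P} \<noteq> {}"
        using P(4) infinite_Ioo[OF uv] by (auto simp: dense_in_partial_rotations_def)
      then have "{u<..<v} \<inter> {s. proj_PC (partial_rotation a l s) \<in> P} \<noteq> {}"
        using open_Int_closure_eq_empty[OF open_greaterThanLessThan] by blast
      then obtain s where s: "u < s" "s < v" "proj_PC (partial_rotation a l s) \<in> P"
        by auto
      then obtain h where h: "h \<in> H" "near h (partial_rotation a l s)"
        using lift P(3) by blast
      \<comment> \<open>Conjugation disturbs a partial rotation only on a finite set, which
        \<open>dense_rotations\<close> tolerates.\<close>
      have "near (?K h) (partial_rotation a l s)"
        using near_conj[OF \<phi> bij_mem[OF h(1)]] h(2) by (rule near_trans)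
      then show "\<exists>s. (\<exists>p\<in>?K ` H. near p (partial_rotation a l s)) \<and> u < s \<and> s < v"
        using h(1) s(1,2) by blast
    qed (fact P)+
  qed
  with \<phi> show thesis
    by (rule that)
qed

theorem theorem4p7:
  fixes \<Gamma> :: "(circle \<Rightarrow> circle) set set"
  assumes "subgroup \<Gamma> PC"
    and "\<exists>\<Lambda>. subgroup \<Lambda> PC \<and> \<Lambda> \<subseteq> \<Gamma> \<and> \<Lambda> \<subseteq> rotations \<and>
           (Q_rank (PC\<lparr>carrier := \<Lambda>\<rparr>) \<ge> 2 \<or>
            \<not> finitely_generated (PC\<lparr>carrier := \<Lambda>\<rparr>) \<and> Q_rank (PC\<lparr>carrier := \<Lambda>\<rparr>) = 1)"
    and "\<exists>a l P. 0 < l \<and> l < 1 \<and> subgroup P PC \<and> P \<subseteq> \<Gamma> \<and>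
           P \<subseteq> partial_rotations a l \<and> dense_in_partial_rotations a l P"
    and "\<exists>f\<in>\<Gamma>. flip_132 f \<or> triple_flip f"
  shows "\<not> realizable \<Gamma>"
proof
  assume "realizable \<Gamma>"
  then obtain H where H: "subgroup H PC_hat" "bij_betw proj_PC H \<Gamma>"
    by (auto simp: realizable_def)
  obtain \<Lambda> where \<Lambda>: "subgroup \<Lambda> PC" "\<Lambda> \<subseteq> \<Gamma>" "\<Lambda> \<subseteq> rotations"
    "Q_rank (PC\<lparr>carrier := \<Lambda>\<rparr>) \<ge> 2 \<or>
     \<not> finitely_generated (PC\<lparr>carrier := \<Lambda>\<rparr>) \<and> Q_rank (PC\<lparr>carrier := \<Lambda>\<rparr>) = 1"
    using assms(2) by blast
  obtain a l P where P: "0 < l" "l < 1" "P \<subseteq> \<Gamma>" "dense_in_partial_rotations a l P"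
    using assms(3) by blast
  obtain f where f: "f \<in> \<Gamma>" "flip_132 f \<or> triple_flip f"
    using assms(4) by blast
  obtain \<phi> where \<phi>: "bij \<phi>" "near \<phi> id"
    and "dense_rotations ((\<lambda>h. inv_into UNIV \<phi> \<circ> h \<circ> \<phi>) ` H) a l"
    using dense_rotations_conj[OF H \<Lambda> P] by blast
  then interpret dense_rotations "(\<lambda>h. inv_into UNIV \<phi> \<circ> h \<circ> \<phi>) ` H" a l
    by blast
  interpret H: lifted_group H
    using H by (intro lifted_group_realization) (auto simp: bij_betw_def)
  obtain h where h: "h \<in> H" "proj_PC h = f"
    using f(1) H(2) by (auto simp: bij_betw_def)
  have h_PC: "h \<in> carrier PC_hat"
    using h(1) subgroup.subset[OF H(1)] by blast
  have "f \<otimes>\<^bsub>PC\<^esub> f = \<one>\<^bsub>PC\<^esub>"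
    using f(2) by (auto simp: flip_132_def triple_flip_def)
  then have "proj_PC (h \<circ> h) = proj_PC id"
    by (simp add: proj_PC_comp h_PC h(2) one_PC)
  then have "near (h \<circ> h) id"
    using proj_PC_eq_iff[OF comp_in_PC_hat[OF h_PC h_PC], of id] PC_hat.one_closed by simp
  \<comment> \<open>The relation is given in the quotient; injectivity of the projection on
    \<open>H\<close> makes the lift an exact involution.\<close>
  then have "h \<circ> h = id"
    using H.near_imp_eq H.comp_mem h(1) H.id_mem by blast
  then have hh: "h (h x) = x" for x
    by (simp add: fun_eq_iff)
  define g where "g = inv_into UNIV \<phi> \<circ> h \<circ> \<phi>"
  have "g (g x) = x" for x
    using \<phi>(1) hh by (simp add: g_def bij_is_inj bij_is_surj surj_f_inv_f)
  moreover have "g \<in> (\<lambda>h. inv_into UNIV \<phi> \<circ> h \<circ> \<phi>) ` H"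
    using h(1) by (simp add: g_def)
  \<comment> \<open>Conjugation by a finitely supported permutation stays in the same coset, so the
    data of the flip apply to \<open>g\<close>.\<close>
  moreover have "g \<in> f"
    using near_conj[OF \<phi> H.bij_mem[OF h(1)]] bij_mem[OF \<open>g \<in> _ ` H\<close>] in_proj_PC_iff[OF h_PC]
    by (simp add: g_def flip: h(2))
  ultimately show False
    using no_flip_mem f(2) by blast
qed

end
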